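(* In the model described in the context, let $s^y\in(0,1)$ be the unique level of economic mobility at which $y_{HP}=y_{LR}$. Fix all primitives other than $s$ and $\rho$. For any social welfare function $W$ that is continuously differentiable, strictly increasing in every agent's utility (with partial derivatives bounded above and bounded away from zero) and (weakly) satisfies the Pigou-Dalton Principle, there exist $\underline{s},\bar{s}$ with $\underline{s}<s^y<\bar{s}$ such that: (i) for all $s\in(0,1)$ with $s<\bar{s}$, equilibrium social welfare is strictly increasing in economic mobility at $s$ (its derivative with respect to $s$ at $s$ is strictly positive) if integration $\rho$ is sufficiently close to $1$ (how close may depend on $s$); and (ii) for all $s\in(0,1)$ with $s>\underline{s}$, equilibrium social welfare is strictly decreasing in economic mobility at $s$ (its derivative with respect to $s$ at $s$ is strictly negative) if integration $\rho$ is sufficiently close to $0$ (how close may depend on $s$).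
   Context: Agents and earning potential. $n$ is a positive integer divisible by $4$, $N=\{1,\dots,n\}$. Each agent $i$ has ability $a_i\in\{H,L\}$ and background $b_i\in\{R,P\}$. The classes are $Q=\{HR,LR,HP,LP\}$ (ability, background); each contains $n/4$ agents; $a_q,b_q$ denote the ability and background of class $q$. $s\in[0,1]$ is economic mobility. An agent in class $q=(a,b)$ has earning potential $y_q=y(a,b,s)\in\mathbb{R}$, continuous in $s\in[0,1]$ and differentiable on $(0,1)$, with: (1) $\frac{dy_{HP}}{ds}=-\frac{dy_{LR}}{ds}>0$ and $\frac{dy_{HR}}{ds}=\frac{dy_{LP}}{ds}=0$ on $(0,1)$; (2) for each $b$, $y(H,b,s)>y(L,b,s)$ for $s\in(0,1)$ and $\lim_{s\to0}[y(H,b,s)-y(L,b,s)]=0$; for each $a$, $y(a,R,s)>y(a,P,s)$ for $s\in(0,1)$ and $\lim_{s\to1}[y(a,R,s)-y(a,P,s)]=0$. Network. $G$ is an $n\times n$ matrix with $G_{ij}\ge0$, $G_{ii}=0$. There are $d>0$, $\omega\in(0,1)$, $\rho\in(0,1)$ ($\rho$ is called integration) such that for all classes $q,q'$ and all $i\in q$: $\sum_{j\in q'}G_{ij}=d\,g_{qq'}$, where $g_{qq'}=\omega$ if $q=q'$; $g_{qq'}=\rho(1-\omega)$ if $q\ne q'$ and $a_q=a_{q'}$; $g_{qq'}=(1-\rho)(1-\omega)$ if $q\neq q'$ and $b_q=b_{q'}$; $g_{qq'}=0$ otherwise. Changing $\rho$ means replacing $G$ by a matrix satisfying these conditions for the new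 $\rho$ with $d,\omega$ unchanged. Game. All agents simultaneously choose $x_i\in[0,\infty)$; payoffs are $U_i=u(x_i,y_i)-\sum_{j:\,x_i\le x_j}G_{ij}F(x_j-x_i)$. $F:[0,\infty)\to\mathbb{R}$ is smooth, strictly increasing and strictly convex with $F(0)=F'(0)=0$. $u:[0,\infty)\times Y\to\mathbb{R}$ ($Y$ an open interval containing all earning potentials $[y_{LP},y_{HR}]$) is twice continuously differentiable; subscripts on $u$ denote partial derivatives; $x^a(y):=\arg\max_{x\ge0}u(x,y)$. Assumption: for all $x\ge0$ and all $y\in Y$: (i) $u_{xx}(x,y)<0$ and $x^a(y)$ exists and is interior ($x^a(y)>0$); (ii) $u_y(x,y)>0$; (iii) $u_{xy}(x,y)>0$ for $x>0$; (iv) $V(y):=\max_{x\ge0}u(x,y)$ is strictly concave. Equilibrium. The solution concept is (pure) Nash equilibrium. The game has a unique Nash equilibrium, in which all agents of a class $q$ choose the same consumption $x_q^*$, depending on $G$ only through $d,\omega,\rho$; $U_i^*$ denotes agent $i$'s equilibrium payoff. Welfare. A social welfare function is a map $W:\mathbb{R}^n\to\mathbb{R}$ of $(U_1,\dots,U_n)$, evaluated at $(U_1^*,\dots,U_n^* )$. It satisfies the (weak) Pigou-Dalton Principle if $W$ weakly increases under any transfer of utility from an agent with higher utility to one with lower utility that does not reverse the ordering of their utilities: if $U_i>U_j$, $\varepsilon>0$ and $U_i-\varepsilon\ge U_j+\varepsilon$, then replacing $(U_i,U_j)$ by $(U_i-\varepsilon,U_j+\varepsilon)$ does not decrease $W$.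 "Partial derivatives bounded above and bounded away from zero" means there are $0<\underline m\le\overline m<\infty$ with $\underline m\le\partial W/\partial U_i\le\overline m$ for all $i$ everywhere. *)

theory Defs
  imports "HOL-Analysis.Analysis"
begin

datatype ability = High | Low

datatype background = Rich | Poor

type_synonym agent_class = "ability \<times> background"

definition strictly_convex_on :: "real set \<Rightarrow> (real \<Rightarrow> real) \<Rightarrow> bool" where
  "strictly_convex_on S f \<longleftrightarrow> convex S \<and>
     (\<forall>x\<in>S. \<forall>y\<in>S. \<forall>t\<in>{0<..<1}. x \<noteq> y \<longrightarrow>
        f ((1 - t) * x + t * y) < (1 - t) * f x + t * f y)"

definition strictly_concave_on :: "real set \<Rightarrow> (real \<Rightarrow> real) \<Rightarrow> bool" where
  "strictly_concave_on S f \<longleftrightarrow> strictly_convex_on S (\<lambda>x. - f x)"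

text \<open>Infinite differentiability on the closed half-line, with one-sided derivatives at \<open>0\<close>;
  \<open>D k\<close> is the \<open>k\<close>-th derivative.\<close>

definition smooth_on_halfline :: "(real \<Rightarrow> real) \<Rightarrow> bool" where
  "smooth_on_halfline f \<longleftrightarrow> (\<exists>D :: nat \<Rightarrow> real \<Rightarrow> real. D 0 = f \<and>
     (\<forall>k. \<forall>x\<ge>0. (D k has_real_derivative D (Suc k) x) (at x within {0..})))"

text \<open>\<open>y a b s\<close> is the earning potential of class \<open>(a, b)\<close> at economic mobility \<open>s\<close>; only
  its values for \<open>s\<close> in \<open>[0, 1]\<close> matter.\<close>

locale earning_potential =
  fixes y :: "ability \<Rightarrow> background \<Rightarrow> real \<Rightarrow> real"
  assumes y_continuous: "\<And>a b. continuous_on {0..1} (y a b)"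
    and y_deriv_HP_LR: "\<And>s. s \<in> {0<..<1} \<Longrightarrow>
      \<exists>v>0. (y High Poor has_real_derivative v) (at s) \<and>
            (y Low Rich has_real_derivative - v) (at s)"
    and y_deriv_HR: "\<And>s. s \<in> {0<..<1} \<Longrightarrow> (y High Rich has_real_derivative 0) (at s)"
    and y_deriv_LP: "\<And>s. s \<in> {0<..<1} \<Longrightarrow> (y Low Poor has_real_derivative 0) (at s)"
    and y_ability: "\<And>b s. s \<in> {0<..<1} \<Longrightarrow> y High b s > y Low b s"
    and y_ability_lim: "\<And>b. ((\<lambda>s. y High b s - y Low b s) \<longlongrightarrow> 0) (at_right 0)"
    and y_background: "\<And>a s. s \<in> {0<..<1} \<Longrightarrow> y a Rich s > y a Poor s"
    and y_background_lim: "\<And>a. ((\<lambda>s. y a Rich s - y a Poor s) \<longlongrightarrow> 0) (at_left 1)"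

text \<open>The definite descriptions \<open>s_y\<close> here and \<open>equilibrium\<close> below are meaningful because the
  assumptions on the primitives entail existence and uniqueness.\<close>

definition s_y :: "(ability \<Rightarrow> background \<Rightarrow> real \<Rightarrow> real) \<Rightarrow> real" where
  "s_y y = (THE s. s \<in> {0<..<1} \<and> y High Poor s = y Low Rich s)"

definition x_a :: "(real \<Rightarrow> real \<Rightarrow> real) \<Rightarrow> real \<Rightarrow> real" where
  "x_a u v = arg_max (\<lambda>x. u x v) (\<lambda>x. 0 \<le> x)"

definition V :: "(real \<Rightarrow> real \<Rightarrow> real) \<Rightarrow> real \<Rightarrow> real" where
  "V u v = u (x_a u v) v"

text \<open>The domain of \<open>u\<close> is \<open>[0, \<infinity>) \<times> Y\<close>, so derivatives in the first argument are one-sided at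
  \<open>0\<close>. The parameters \<open>u_x, \<dots>, u_yy\<close> are the (uniquely determined) first and second partial
  derivatives; their existence and continuity is what it means for \<open>u\<close> to be twice continuously
  differentiable.\<close>

locale consumption_utility =
  fixes Y :: "real set"
    and u u_x u_y u_xx u_xy u_yx u_yy :: "real \<Rightarrow> real \<Rightarrow> real"
  assumes Y_open: "open Y"
    and Y_interval: "is_interval Y"
    and has_u_x: "\<And>x v. 0 \<le> x \<Longrightarrow> v \<in> Y \<Longrightarrow>
      ((\<lambda>t. u t v) has_real_derivative u_x x v) (at x within {0..})"
    and has_u_y: "\<And>x v. 0 \<le> x \<Longrightarrow> v \<in> Y \<Longrightarrow>
      (u x has_real_derivative u_y x v) (at v)"
    and has_u_xx: "\<And>x v. 0 \<le> x \<Longrightarrow> v \<in> Y \<Longrightarrow>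
      ((\<lambda>t. u_x t v) has_real_derivative u_xx x v) (at x within {0..})"
    and has_u_xy: "\<And>x v. 0 \<le> x \<Longrightarrow> v \<in> Y \<Longrightarrow>
      (u_x x has_real_derivative u_xy x v) (at v)"
    and has_u_yx: "\<And>x v. 0 \<le> x \<Longrightarrow> v \<in> Y \<Longrightarrow>
      ((\<lambda>t. u_y t v) has_real_derivative u_yx x v) (at x within {0..})"
    and has_u_yy: "\<And>x v. 0 \<le> x \<Longrightarrow> v \<in> Y \<Longrightarrow>
      (u_y x has_real_derivative u_yy x v) (at v)"
    and partials_continuous:
      "\<And>f. f \<in> {u, u_x, u_y, u_xx, u_xy, u_yx, u_yy} \<Longrightarrow>
        continuous_on ({0..} \<times> Y) (\<lambda>(x, v). f x v)"
    and u_xx_neg: "\<And>x v. 0 \<le> x \<Longrightarrow> v \<in> Y \<Longrightarrow> u_xx x v < 0"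
    and x_a_exists: "\<And>v. v \<in> Y \<Longrightarrow> is_arg_max (\<lambda>x. u x v) (\<lambda>x. 0 \<le> x) (x_a u v)"
    and x_a_interior: "\<And>v. v \<in> Y \<Longrightarrow> 0 < x_a u v"
    and u_y_pos: "\<And>x v. 0 \<le> x \<Longrightarrow> v \<in> Y \<Longrightarrow> 0 < u_y x v"
    and u_xy_pos: "\<And>x v. 0 < x \<Longrightarrow> v \<in> Y \<Longrightarrow> 0 < u_xy x v"
    and V_strictly_concave: "strictly_concave_on Y (V u)"

locale comparison_cost =
  fixes F :: "real \<Rightarrow> real"
  assumes F_smooth: "smooth_on_halfline F"
    and F_strict_mono: "strict_mono_on {0..} F"
    and F_strictly_convex: "strictly_convex_on {0..} F"
    and F_0: "F 0 = 0"
    and F_deriv_0: "(F has_real_derivative 0) (at 0 within {0..})"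

text \<open>Agents are the elements of the finite type \<open>'n\<close>, so \<open>n = CARD('n)\<close>; profiles of
  consumption levels and of utilities are vectors in \<open>real ^ 'n\<close>.\<close>

locale population =
  fixes cls :: "'n::finite \<Rightarrow> agent_class"
  assumes four_dvd: "4 dvd CARD('n)"
    and class_size: "\<And>q. card {i. cls i = q} = CARD('n) div 4"

definition link_share :: "real \<Rightarrow> real \<Rightarrow> agent_class \<Rightarrow> agent_class \<Rightarrow> real" where
  "link_share \<omega> \<rho> q q' =
     (if q = q' then \<omega>
      else if fst q = fst q' then \<rho> * (1 - \<omega>)
      else if snd q = snd q' then (1 - \<rho>) * (1 - \<omega>)
      else 0)"

definition network ::
  "('n::finite \<Rightarrow> agent_class) \<Rightarrow> real \<Rightarrow> real \<Rightarrow> real \<Rightarrow> real ^ 'n ^ 'n \<Rightarrow> bool" where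
  "network cls d \<omega> \<rho> G \<longleftrightarrow>
     0 < d \<and> \<omega> \<in> {0<..<1} \<and> \<rho> \<in> {0<..<1} \<and>
     (\<forall>i j. 0 \<le> G $ i $ j) \<and> (\<forall>i. G $ i $ i = 0) \<and>
     (\<forall>i q'. (\<Sum>j | cls j = q'. G $ i $ j) = d * link_share \<omega> \<rho> (cls i) q')"

text \<open>Here \<open>e i\<close> is the earning potential of agent \<open>i\<close>.\<close>

definition payoff :: "(real \<Rightarrow> real \<Rightarrow> real) \<Rightarrow> (real \<Rightarrow> real) \<Rightarrow> real ^ 'n ^ 'n \<Rightarrow>
    ('n::finite \<Rightarrow> real) \<Rightarrow> real ^ 'n \<Rightarrow> 'n \<Rightarrow> real" where
  "payoff u F G e x i =
     u (x $ i) (e i) - (\<Sum>j | x $ i \<le> x $ j. G $ i $ j * F (x $ j - x $ i))"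

definition nash_equilibrium :: "(real \<Rightarrow> real \<Rightarrow> real) \<Rightarrow> (real \<Rightarrow> real) \<Rightarrow> real ^ 'n ^ 'n \<Rightarrow>
    ('n::finite \<Rightarrow> real) \<Rightarrow> real ^ 'n \<Rightarrow> bool" where
  "nash_equilibrium u F G e x \<longleftrightarrow>
     (\<forall>i. 0 \<le> x $ i) \<and>
     (\<forall>i. \<forall>z\<ge>0. payoff u F G e (\<chi> j. if j = i then z else x $ j) i \<le> payoff u F G e x i)"

definition equilibrium :: "(real \<Rightarrow> real \<Rightarrow> real) \<Rightarrow> (real \<Rightarrow> real) \<Rightarrow> real ^ 'n ^ 'n \<Rightarrow>
    ('n::finite \<Rightarrow> real) \<Rightarrow> real ^ 'n" where
  "equilibrium u F G e = (THE x. nash_equilibrium u F G e x)"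

definition equilibrium_payoffs :: "(real \<Rightarrow> real \<Rightarrow> real) \<Rightarrow> (real \<Rightarrow> real) \<Rightarrow>
    real ^ 'n ^ 'n \<Rightarrow> ('n::finite \<Rightarrow> real) \<Rightarrow> real ^ 'n" where
  "equilibrium_payoffs u F G e = (\<chi> i. payoff u F G e (equilibrium u F G e) i)"

definition equilibrium_welfare ::
  "('n::finite \<Rightarrow> agent_class) \<Rightarrow> (ability \<Rightarrow> background \<Rightarrow> real \<Rightarrow> real) \<Rightarrow>
   (real \<Rightarrow> real \<Rightarrow> real) \<Rightarrow> (real \<Rightarrow> real) \<Rightarrow> (real ^ 'n \<Rightarrow> real) \<Rightarrow>
   real ^ 'n ^ 'n \<Rightarrow> real \<Rightarrow> real" where
  "equilibrium_welfare cls y u F W G s =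
     W (equilibrium_payoffs u F G (\<lambda>i. y (fst (cls i)) (snd (cls i)) s))"

definition pigou_dalton :: "(real ^ 'n::finite \<Rightarrow> real) \<Rightarrow> bool" where
  "pigou_dalton W \<longleftrightarrow>
     (\<forall>U i j \<epsilon>. U $ i > U $ j \<and> \<epsilon> > 0 \<and> U $ i - \<epsilon> \<ge> U $ j + \<epsilon> \<longrightarrow>
        W U \<le> W (\<chi> k. if k = i then U $ i - \<epsilon> else if k = j then U $ j + \<epsilon> else U $ k))"

definition strictly_increasing_in_each :: "(real ^ 'n::finite \<Rightarrow> real) \<Rightarrow> bool" where
  "strictly_increasing_in_each W \<longleftrightarrow>
     (\<forall>U i t. U $ i < t \<longrightarrow> W U < W (\<chi> k. if k = i then t else U $ k))"

text \<open>The components of the gradient \<open>DW U\<close> are the partial derivatives of \<open>W\<close> at \<open>U\<close>.\<close>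

definition C1_bounded_partials :: "(real ^ 'n::finite \<Rightarrow> real) \<Rightarrow> bool" where
  "C1_bounded_partials W \<longleftrightarrow>
     (\<exists>DW :: real ^ 'n \<Rightarrow> real ^ 'n.
        (\<forall>U. (W has_derivative (\<lambda>h. DW U \<bullet> h)) (at U)) \<and>
        continuous_on UNIV DW \<and>
        (\<exists>m M. 0 < m \<and> m \<le> M \<and> (\<forall>U i. m \<le> DW U $ i \<and> DW U $ i \<le> M)))"

end

theory Submission
  imports Defs
begin

text \<open>Comparisons are upward, so the first-order conditions are triangular: \<open>HR\<close> consumes its
  autarkic optimum, \<open>HP\<close> and \<open>LR\<close> each lag behind \<open>HR\<close> only, and \<open>LP\<close> lags behind both. By the
  envelope theorem a marginal rise in mobility raises the utility of \<open>HP\<close> at rate \<open>u_y\<close> and lowers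
  that of \<open>LR\<close> at rate \<open>u_y\<close>; \<open>LP\<close> is affected only through its targets. As \<open>\<rho> \<rightarrow> 1\<close> the class
  \<open>LR\<close> decouples from \<open>HR\<close> and \<open>LP\<close> decouples from \<open>HP\<close>. Overconsumption then leaves \<open>HP\<close> with
  lower utility and higher marginal utility of income than \<open>LR\<close> (here concavity of \<open>V\<close> enters),
  strictly even at \<open>s\<^sup>y\<close>, so by Pigou-Dalton the gain of \<open>HP\<close> outweighs the loss of \<open>LR\<close>; the only
  adverse effect on \<open>LP\<close> vanishes with the weight of its link to \<open>HP\<close>. The case \<open>\<rho> \<rightarrow> 0\<close> is
  the same with \<open>HP\<close> and \<open>LR\<close> exchanged.\<close>

text \<open>The classes HP and LR share neither ability nor background, so no link joins them and
  their relative order never matters; this is why consumption can be solved for one class at a time.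
  The values 0 and 1 of \<rho> are not admissible networks, so limits are taken in the response
  functions, which remain meaningful when a link intensity is 0. The decisive comparison,
  \<open>favours\<close>, is a pair of strict inequalities and hence open: openness in
  \<open>s\<close> gives the room beyond \<open>s_y\<close>, openness in \<rho> gives the
  neighbourhood of the limit. Overconsumption raises \<open>u_y\<close> through \<open>u_yx\<close>,
  whereas the model signs \<open>u_xy\<close>, so symmetry of the mixed partials has to be
  established. The main obstacle is that marginal comparison cost may have a kink at gap zero (when
  F''(0) > 0): derivatives of responses are taken only at strictly positive gaps, so strict
  orderings of consumption come before differentiation. Finally, the gradient of \<open>W\<close>
  moves with \<rho> and \<open>G\<close>; the bounds \<open>m\<close> and \<open>M\<close> make the
  estimates uniform.\<close>

section \<open>Limits and derivatives of roots and of composed functions of two variables\<close>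

text \<open>Pointwise convergence suffices: the sign of \<open>g0\<close> at a fixed point passes to
  \<open>g s\<close> at that point, and monotonicity then places the root of \<open>g s\<close> on
  the correct side of it.\<close>

lemma root_tendsto:
  fixes g :: "'s \<Rightarrow> real \<Rightarrow> real" and g0 :: "real \<Rightarrow> real"
  assumes root: "\<forall>\<^sub>F s in \<F>. 0 \<le> X s \<and> g s (X s) = 0"
    and decr: "\<forall>\<^sub>F s in \<F>. \<forall>x x'. 0 \<le> x \<longrightarrow> x < x' \<longrightarrow> g s x' < g s x"
    and root0: "0 < x0" "g0 x0 = 0"
    and decr0: "\<And>x x'. 0 \<le> x \<Longrightarrow> x < x' \<Longrightarrow> g0 x' < g0 x"
    and lim: "\<And>x. 0 \<le> x \<Longrightarrow> ((\<lambda>s. g s x) \<longlongrightarrow> g0 x) \<F>"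
  shows "(X \<longlongrightarrow> x0) \<F>"
proof (rule order_tendstoI)
  fix a assume "a < x0"
  \<comment> \<open>The bound \<open>a\<close> may be negative, where nothing is assumed;
    \<open>b\<close> is a nonnegative point between \<open>a\<close> and \<open>x0\<close>.\<close>
  define b where "b = max a (x0 / 2)"
  have b: "0 \<le> b" "b < x0" "a \<le> b" using \<open>a < x0\<close> root0 by (auto simp: b_def)
  have "0 < g0 b" using decr0[of b x0] b root0 by simp
  then have "\<forall>\<^sub>F s in \<F>. 0 < g s b" using lim[OF b(1)] by (rule order_tendstoD(1)[rotated])
  then show "\<forall>\<^sub>F s in \<F>. a < X s"
    using root decr
  proof eventually_elim
    case (elim s)
    have "\<not> X s < b" using elim by force
    moreover have "X s \<noteq> b" using elim by auto
    ultimately show ?case using b by linarith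
  qed
next
  fix b assume "x0 < b"
  have "g0 b < 0" using decr0[of x0 b] \<open>x0 < b\<close> root0 by simp
  moreover have "((\<lambda>s. g s b) \<longlongrightarrow> g0 b) \<F>" using \<open>x0 < b\<close> root0 lim by simp
  ultimately have "\<forall>\<^sub>F s in \<F>. g s b < 0" by (rule order_tendstoD(2)[rotated])
  then show "\<forall>\<^sub>F s in \<F>. X s < b"
    using root decr
  proof eventually_elim
    case (elim s)
    have "0 \<le> b" using \<open>x0 < b\<close> root0 by simp
    then have "\<not> b < X s" using elim by force
    moreover have "X s \<noteq> b" using elim by auto
    ultimately show ?case by linarith
  qed
qed

lemma mvt_segment:
  fixes h h' :: "real \<Rightarrow> real"
  assumes "\<And>x. x \<in> closed_segment a b \<Longrightarrow> (h has_real_derivative h' x) (at x)"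
  shows "\<exists>\<xi>\<in>closed_segment a b. h b - h a = h' \<xi> * (b - a)"
proof (cases a b rule: linorder_cases)
  case less
  then have "\<exists>z>a. z < b \<and> h b - h a = (b - a) * h' z"
    using assms by (intro MVT2) (auto simp: closed_segment_eq_real_ivl)
  then show ?thesis using less by (auto simp: closed_segment_eq_real_ivl mult.commute)
next
  case greater
  then have "\<exists>z>b. z < a \<and> h a - h b = (a - b) * h' z"
    using assms by (intro MVT2) (auto simp: closed_segment_eq_real_ivl)
  then obtain z where "b < z" "z < a" "h a - h b = (a - b) * h' z" by blast
  then show ?thesis using greater
    by (intro bexI[of _ z]) (auto simp: closed_segment_eq_real_ivl algebra_simps)
qed auto

lemma tendsto_in_segment:
  fixes X \<xi> :: "'s \<Rightarrow> real"
  assumes "(X \<longlongrightarrow> x0) \<F>" "\<forall>\<^sub>F s in \<F>. \<xi> s \<in> closed_segment x0 (X s)"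
  shows "(\<xi> \<longlongrightarrow> x0) \<F>"
proof (rule tendsto_sandwich)
  show "((\<lambda>s. min x0 (X s)) \<longlongrightarrow> x0) \<F>" "((\<lambda>s. max x0 (X s)) \<longlongrightarrow> x0) \<F>"
    using tendsto_min[OF tendsto_const assms(1), of x0] tendsto_max[OF tendsto_const assms(1), of x0]
    by simp_all
qed (use assms(2) in \<open>auto elim!: eventually_mono simp: closed_segment_eq_real_ivl split: if_splits\<close>)

text \<open>The mean value theorem is applied in \<open>x\<close> alone, at mobility
  \<open>s\<close>, and differentiability in \<open>s\<close> is used only at the fixed point
  \<open>X s0\<close>. Thus \<open>gx\<close> matters only along points that tend to
  \<open>X s0\<close>, away from any kink of \<open>g\<close>. Continuity of \<open>X\<close> is an
  input and comes from monotone roots.\<close>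

lemma implicit_derivative:
  fixes X :: "real \<Rightarrow> real" and g gx :: "real \<Rightarrow> real \<Rightarrow> real"
  assumes X: "(X \<longlongrightarrow> X s0) (at s0)"
    and root: "\<forall>\<^sub>F s in at s0. g (X s) s = 0" "g (X s0) s0 = 0"
    and ds: "((\<lambda>s. g (X s0) s) has_real_derivative gs) (at s0)"
    and dx: "\<forall>\<^sub>F s in at s0. \<forall>x\<in>closed_segment (X s0) (X s).
      ((\<lambda>x. g x s) has_real_derivative gx x s) (at x)"
    and lim: "\<And>\<xi>. (\<xi> \<longlongrightarrow> X s0) (at s0) \<Longrightarrow> ((\<lambda>s. gx (\<xi> s) s) \<longlongrightarrow> l) (at s0)"
    and l: "l \<noteq> 0"
  shows "(X has_real_derivative - gs / l) (at s0)"
proof -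
  have "\<forall>\<^sub>F s in at s0. \<exists>\<xi>. \<xi> \<in> closed_segment (X s0) (X s) \<and>
      g (X s) s - g (X s0) s = gx \<xi> s * (X s - X s0)"
    using dx
  proof eventually_elim
    case (elim s)
    then show ?case using mvt_segment[of "X s0" "X s" "\<lambda>x. g x s" "\<lambda>x. gx x s"] by blast
  qed
  then obtain \<xi> where \<xi>: "\<forall>\<^sub>F s in at s0. \<xi> s \<in> closed_segment (X s0) (X s) \<and>
      g (X s) s - g (X s0) s = gx (\<xi> s) s * (X s - X s0)"
    unfolding eventually_ex by blast
  have "(\<xi> \<longlongrightarrow> X s0) (at s0)"
    using X \<xi> by (rule tendsto_in_segment[OF _ eventually_mono]) auto
  then have gx: "((\<lambda>s. gx (\<xi> s) s) \<longlongrightarrow> l) (at s0)" by (rule lim)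
  have "((\<lambda>s. - ((g (X s0) s - g (X s0) s0) / (s - s0)) / gx (\<xi> s) s) \<longlongrightarrow> - gs / l) (at s0)"
    using ds unfolding has_field_derivative_iff
    by (intro tendsto_divide tendsto_minus gx l) simp
  moreover have "\<forall>\<^sub>F s in at s0. - ((g (X s0) s - g (X s0) s0) / (s - s0)) / gx (\<xi> s) s =
      (X s - X s0) / (s - s0)"
    using root(1) \<xi> tendsto_imp_eventually_ne[OF gx l]
  proof eventually_elim
    case (elim s)
    have "- g (X s0) s = gx (\<xi> s) s * (X s - X s0)" using elim by simp
    then have "- (g (X s0) s) / gx (\<xi> s) s = X s - X s0" using elim by (simp add: field_simps)
    then have "- (g (X s0) s) / gx (\<xi> s) s / (s - s0) = (X s - X s0) / (s - s0)" by simp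
    then show ?case using root(2) by (simp add: mult.commute)
  qed
  ultimately show ?thesis
    unfolding has_field_derivative_iff by (rule Lim_transform_eventually)
qed

text \<open>The increment splits into a move of the first argument at fixed \<open>v0\<close> and a
  move of the second at fixed \<open>X v\<close>. With the first-order condition, which makes the
  first part vanish, this yields the envelope theorem.\<close>

lemma diagonal_derivative:
  fixes X :: "real \<Rightarrow> real" and h hv :: "real \<Rightarrow> real \<Rightarrow> real"
  assumes X: "(X has_real_derivative X') (at v0)"
    and hx: "((\<lambda>x. h x v0) has_real_derivative hx) (at (X v0))"
    and dv: "\<forall>\<^sub>F v in at v0. \<forall>w\<in>closed_segment v0 v. (h (X v) has_real_derivative hv (X v) w) (at w)"
    and lim: "\<And>\<xi>. (\<xi> \<longlongrightarrow> v0) (at v0) \<Longrightarrow> ((\<lambda>v. hv (X v) (\<xi> v)) \<longlongrightarrow> l) (at v0)"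
  shows "((\<lambda>v. h (X v) v) has_real_derivative hx * X' + l) (at v0)"
proof -
  have "\<forall>\<^sub>F v in at v0. \<exists>\<xi>. \<xi> \<in> closed_segment v0 v \<and>
      h (X v) v - h (X v) v0 = hv (X v) \<xi> * (v - v0)"
    using dv
  proof eventually_elim
    case (elim v)
    then show ?case using mvt_segment[of v0 v "h (X v)" "hv (X v)"] by blast
  qed
  then obtain \<xi> where \<xi>: "\<forall>\<^sub>F v in at v0. \<xi> v \<in> closed_segment v0 v \<and>
      h (X v) v - h (X v) v0 = hv (X v) (\<xi> v) * (v - v0)"
    unfolding eventually_ex by blast
  have "(\<xi> \<longlongrightarrow> v0) (at v0)"
    using \<xi> by (intro tendsto_in_segment[OF tendsto_ident_at eventually_mono[OF \<xi>]]) auto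
  then have 1: "((\<lambda>v. hv (X v) (\<xi> v)) \<longlongrightarrow> l) (at v0)" by (rule lim)
  have 2: "((\<lambda>v. h (X v) v0) has_real_derivative hx * X') (at v0)"
    using DERIV_chain2[OF hx X] .
  have "((\<lambda>v. (h (X v) v0 - h (X v0) v0) / (v - v0) + hv (X v) (\<xi> v)) \<longlongrightarrow> hx * X' + l) (at v0)"
    using 2 unfolding has_field_derivative_iff by (intro tendsto_add 1) simp
  moreover have "\<forall>\<^sub>F v in at v0. (h (X v) v0 - h (X v0) v0) / (v - v0) + hv (X v) (\<xi> v) =
      (h (X v) v - h (X v0) v0) / (v - v0)"
    using \<xi> eventually_neq_at_within[of v0 v0 UNIV]
  proof eventually_elim
    case (elim v)
    have "hv (X v) (\<xi> v) = (h (X v) v - h (X v) v0) / (v - v0)" using elim by simp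
    then show ?case by (simp add: diff_divide_distrib)
  qed
  ultimately show ?thesis
    unfolding has_field_derivative_iff by (rule Lim_transform_eventually)
qed

section \<open>Marginal comparison cost from convexity\<close>

lemma at_within_nonneg: "0 < (t::real) \<Longrightarrow> at t within {0..} = at t"
  by (rule at_within_interior) simp

lemma strictly_convex_on_imp_convex_on:
  assumes "strictly_convex_on S h"
  shows "convex_on S h"
proof (rule convex_onI)
  show "convex S" using assms by (simp add: strictly_convex_on_def)
  fix t x z :: real assume *: "0 < t" "t < 1" "x \<in> S" "z \<in> S"
  show "h ((1 - t) *\<^sub>R x + t *\<^sub>R z) \<le> (1 - t) * h x + t * h z"
  proof (cases "x = z")
    case True
    then show ?thesis by (simp add: algebra_simps)
  next
    case False
    then show ?thesis
      using assms * unfolding strictly_convex_on_def by (auto intro!: less_imp_le)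
  qed
qed

locale status_game = consumption_utility +
  fixes F f f' :: "real \<Rightarrow> real"
  assumes F_deriv: "0 \<le> t \<Longrightarrow> (F has_real_derivative f t) (at t within {0..})"
    and f_deriv: "0 \<le> t \<Longrightarrow> (f has_real_derivative f' t) (at t within {0..})"
    and f'_continuous: "continuous_on {0..} f'"
    and f_mono: "0 \<le> s \<Longrightarrow> s \<le> t \<Longrightarrow> f s \<le> f t"
    and f_zero: "f 0 = 0"
    and f_pos: "0 < t \<Longrightarrow> 0 < f t"
    and F_zero: "F 0 = 0"
    and F_pos: "0 < t \<Longrightarrow> 0 < F t"

text \<open>The functions \<open>f\<close> and \<open>f'\<close> are F' and F''. The tangent of
  \<open>F\<close> at \<open>t\<close>, evaluated at 0, gives positivity of F'; adding the tangent
  inequalities at \<open>s\<close> and \<open>t\<close> gives its monotonicity. Tangents are taken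
  only at positive points, so the point 0 is treated through F'(0) = 0.\<close>

lemma status_game_if_comparison_cost:
  assumes "comparison_cost F" "consumption_utility Y u u_x u_y u_xx u_xy u_yx u_yy"
  shows "\<exists>f f'. status_game Y u u_x u_y u_xx u_xy u_yx u_yy F f f'"
proof -
  interpret comparison_cost F by fact
  obtain D :: "nat \<Rightarrow> real \<Rightarrow> real" where D: "D 0 = F"
    "\<And>k x. 0 \<le> x \<Longrightarrow> (D k has_real_derivative D (Suc k) x) (at x within {0..})"
    using F_smooth unfolding smooth_on_halfline_def by auto
  have deriv: "(F has_real_derivative D 1 t) (at t within {0..})" if "0 \<le> t" for t
    using D(2)[OF that, of 0] D(1) by simp
  have pos: "0 < F t" if "0 < t" for t
    using strict_mono_onD[OF F_strict_mono, of 0 t] that F_0 by simp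
  note convex = strictly_convex_on_imp_convex_on[OF F_strictly_convex]
  have tangent: "D 1 t * (s - t) \<le> F s - F t" if "0 < t" "0 \<le> s" for s t
    using that
    by (intro convex_on_imp_above_tangent[OF convex _ _ _ deriv]) auto
  have 0: "D 1 0 = 0"
    using has_field_derivative_unique[OF deriv[of 0] F_deriv_0] by (simp add: at_within_Ici_at_right)
  have fpos: "0 < D 1 t" if "0 < t" for t
  proof (rule zero_less_mult_pos2)
    show "0 < D 1 t * t" using tangent[of t 0] pos[OF that] that F_0 by simp
  qed fact
  have fmono: "D 1 s \<le> D 1 t" if "0 \<le> s" "s \<le> t" for s t
  proof (cases "s = 0 \<or> s = t")
    case True then show ?thesis using fpos[of t] 0 that by (cases "t = 0") auto
  next
    case False
    then have "0 \<le> (D 1 t - D 1 s) * (t - s)"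
      using tangent[of s t] tangent[of t s] that by (simp add: algebra_simps)
    then show ?thesis using False that by (simp add: zero_le_mult_iff)
  qed
  have "continuous_on {0..} (D 2)"
    using D(2)[of _ 2] by (auto intro!: DERIV_continuous_on)
  moreover have "(D 1 has_real_derivative D 2 t) (at t within {0..})" if "0 \<le> t" for t
    using D(2)[OF that, of 1] by (simp add: numeral_2_eq_2)
  ultimately have "status_game_axioms F (D 1) (D 2)"
    using deriv fmono fpos pos 0 F_0 by unfold_locales auto
  then show ?thesis using assms(2) unfolding status_game_def by blast
qed

section \<open>Comparison cost extended to negative gaps\<close>

context status_game
begin

text \<open>Extension by zero turns the sum over agents consuming weakly more into a sum over all
  agents, so that the index set no longer moves with the profile.\<close>

definition cost :: "real \<Rightarrow> real" where
  "cost t = F (max t 0)"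

definition mcost :: "real \<Rightarrow> real" where
  "mcost t = f (max t 0)"

lemma cost_nonpos [simp]: "t \<le> 0 \<Longrightarrow> cost t = 0"
  and mcost_nonpos [simp]: "t \<le> 0 \<Longrightarrow> mcost t = 0"
  by (simp_all add: cost_def mcost_def F_zero f_zero)

lemma cost_pos: "0 < t \<Longrightarrow> 0 < cost t"
  and mcost_pos: "0 < t \<Longrightarrow> 0 < mcost t"
  by (simp_all add: cost_def mcost_def F_pos f_pos)

lemma mcost_nonneg: "0 \<le> mcost t"
  using mcost_pos[of t] by (cases "0 < t") auto

lemma mcost_mono: "s \<le> t \<Longrightarrow> mcost s \<le> mcost t"
  unfolding mcost_def by (rule f_mono) auto

text \<open>Restricted to positive gaps because the left derivative at 0 is 0 while the right one is
  F''(0).\<close>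

lemma mcost_deriv:
  assumes "0 < t"
  shows "(mcost has_real_derivative f' t) (at t)"
  by (rule has_field_derivative_transform_within_open[of f _ t "{0<..}"])
    (use assms f_deriv[of t] in \<open>auto simp: at_within_nonneg mcost_def\<close>)

text \<open>At gap 0 the two one-sided quotients agree because F'(0) = 0.\<close>

lemma cost_deriv: "(cost has_real_derivative mcost t) (at t)"
proof (cases t "0 :: real" rule: linorder_cases)
  case less
  have "(cost has_real_derivative 0) (at t)"
    by (rule has_field_derivative_transform_within_open[of "\<lambda>_. 0" _ t "{..<0}"])
      (use less in auto)
  then show ?thesis using less by simp
next
  case greater
  have "(cost has_real_derivative f t) (at t)"
    by (rule has_field_derivative_transform_within_open[of F _ t "{0<..}"])
      (use greater F_deriv[of t] in \<open>auto simp: at_within_nonneg cost_def\<close>)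
  then show ?thesis using greater by (simp add: mcost_def)
next
  case equal
  have "((\<lambda>s. F s / s) \<longlongrightarrow> 0) (at_right 0)"
    using F_deriv[of 0] by (simp add: has_field_derivative_iff F_zero f_zero at_within_Ici_at_right)
  then have "((\<lambda>s. cost s / s) \<longlongrightarrow> 0) (at_right 0)"
    by (rule Lim_transform_eventually) (simp add: eventually_at_right_less cost_def
        eventually_mono[OF eventually_at_right_less])
  moreover have "((\<lambda>s. cost s / s) \<longlongrightarrow> 0) (at_left 0)"
    by (rule tendsto_eventually) (simp add: eventually_at_filter)
  ultimately show ?thesis
    using equal by (simp add: has_field_derivative_iff filterlim_split_at)
qed

lemma mcost_continuous: "continuous_on UNIV mcost"
proof -
  have "continuous_on {0..} f" using f_deriv by (auto intro!: DERIV_continuous_on)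
  then show ?thesis
    unfolding mcost_def
    by (rule continuous_on_compose2) (auto intro!: continuous_intros)
qed

lemma mcost_tendsto: "(X \<longlongrightarrow> x) \<F> \<Longrightarrow> ((\<lambda>s. mcost (X s)) \<longlongrightarrow> mcost x) \<F>"
  using mcost_continuous by (intro isCont_tendsto_compose[of _ mcost]) (auto simp: continuous_on_eq_continuous_at)

lemma cost_tendsto: "(X \<longlongrightarrow> x) \<F> \<Longrightarrow> ((\<lambda>s. cost (X s)) \<longlongrightarrow> cost x) \<F>"
  by (intro isCont_tendsto_compose[of _ cost] DERIV_isCont[OF cost_deriv])

lemma f'_tendsto: "(X \<longlongrightarrow> x) \<F> \<Longrightarrow> 0 < x \<Longrightarrow> ((\<lambda>s. f' (X s)) \<longlongrightarrow> f' x) \<F>"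
  using f'_continuous
  by (intro isCont_tendsto_compose[of _ f'] continuous_on_interior[of "{0..}"]) auto

lemma f'_nonneg: "0 < t \<Longrightarrow> 0 \<le> f' t"
proof (rule ccontr)
  assume "0 < t" "\<not> 0 \<le> f' t"
  then obtain e where "0 < e" "\<forall>h>0. h < e \<longrightarrow> mcost (t + h) < mcost t"
    using DERIV_neg_dec_right[OF mcost_deriv[of t]] by auto
  then show False using mcost_mono[of t "t + e / 2"] by (auto dest: spec[of _ "e / 2"])
qed

section \<open>Partial derivatives of utility\<close>

lemma partial_tendsto:
  assumes "h \<in> {u, u_x, u_y, u_xx, u_xy, u_yx, u_yy}"
    and "(X \<longlongrightarrow> x) \<F>" "(v \<longlongrightarrow> v0) \<F>" "0 < x" "v0 \<in> Y"
  shows "((\<lambda>s. h (X s) (v s)) \<longlongrightarrow> h x v0) \<F>"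
proof -
  have "isCont (\<lambda>(x, v). h x v) (x, v0)"
    using Y_open assms
    by (intro continuous_on_interior[OF partials_continuous[OF assms(1)]])
      (auto simp: interior_Times interior_open)
  from isCont_tendsto_compose[OF this tendsto_Pair[OF assms(2,3)]] show ?thesis by simp
qed

lemma u_x_strict_anti:
  assumes "v \<in> Y" "0 \<le> x" "x < z"
  shows "u_x z v < u_x x v"
proof -
  have "\<exists>\<xi>\<in>{x<..<z}. u_x z v - u_x x v = u_xx \<xi> v * (z - x)"
    using assms
    by (intro mvt_simple) (auto intro!: has_field_derivative_subset[OF has_u_xx]
        simp flip: has_field_derivative_def)
  then obtain \<xi> where \<xi>: "\<xi> \<in> {x<..<z}" "u_x z v - u_x x v = u_xx \<xi> v * (z - x)" by blast
  moreover have "u_xx \<xi> v * (z - x) < 0"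
    using assms \<xi>(1) u_xx_neg[of \<xi> v] by (intro mult_neg_pos) auto
  ultimately show ?thesis by simp
qed

lemma x_a_foc:
  assumes "v \<in> Y"
  shows "u_x (x_a u v) v = 0"
proof (rule DERIV_local_max)
  show "((\<lambda>t. u t v) has_real_derivative u_x (x_a u v) v) (at (x_a u v))"
    using has_u_x[of "x_a u v" v] x_a_interior[OF assms] assms by (simp add: at_within_nonneg)
  show "0 < x_a u v" by (rule x_a_interior[OF assms])
  show "\<forall>z. \<bar>x_a u v - z\<bar> < x_a u v \<longrightarrow> u z v \<le> u (x_a u v) v"
    using x_a_exists[OF assms] by (auto simp: is_arg_max_linorder)
qed

lemma u_strict_mono_v:
  assumes "0 \<le> x" "v \<in> Y" "w \<in> Y" "v < w"
  shows "u x v < u x w"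
proof (rule DERIV_pos_imp_increasing[OF assms(4)])
  fix t assume "v \<le> t" "t \<le> w"
  then have "t \<in> Y" using Y_interval assms by (meson is_interval_1)
  then show "\<exists>y. (u x has_real_derivative y) (at t) \<and> 0 < y"
    using has_u_y[of x t] u_y_pos[of x t] assms(1) by auto
qed

lemma u_x_strict_mono_v:
  assumes "0 < x" "v \<in> Y" "w \<in> Y" "v < w"
  shows "u_x x v < u_x x w"
proof (rule DERIV_pos_imp_increasing[OF assms(4)])
  fix t assume "v \<le> t" "t \<le> w"
  then have "t \<in> Y" using Y_interval assms by (meson is_interval_1)
  then show "\<exists>y. (u_x x has_real_derivative y) (at t) \<and> 0 < y"
    using has_u_xy[of x t] u_xy_pos[of x t] assms(1) by auto
qed

lemma has_u_x_at: "0 < x \<Longrightarrow> v \<in> Y \<Longrightarrow> ((\<lambda>t. u t v) has_real_derivative u_x x v) (at x)"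
  and has_u_xx_at: "0 < x \<Longrightarrow> v \<in> Y \<Longrightarrow> ((\<lambda>t. u_x t v) has_real_derivative u_xx x v) (at x)"
  and has_u_yx_at: "0 < x \<Longrightarrow> v \<in> Y \<Longrightarrow> ((\<lambda>t. u_y t v) has_real_derivative u_yx x v) (at x)"
  using has_u_x[of x v] has_u_xx[of x v] has_u_yx[of x v] by (simp_all add: at_within_nonneg)

text \<open>The second difference of \<open>u\<close> over a square of side \<open>h\<close> equals
  \<open>h\<close> squared times a value of \<open>u_xy\<close> or of \<open>u_yx\<close>, according
  to the order in which the mean value theorem is applied. The square extends up and to the right of
  the point and shrinks to it, and both partials are continuous.\<close>

lemma mixed_partials_eq:
  assumes "0 < x" "v \<in> Y"
  shows "u_yx x v = u_xy x v"
proof -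
  have square: "\<exists>\<xi> \<eta> \<xi>' \<eta>'. \<xi> \<in> {x..x + h} \<and> \<eta> \<in> {v..v + h} \<and> \<xi>' \<in> {x..x + h} \<and> \<eta>' \<in> {v..v + h} \<and>
      u_xy \<xi> \<eta> = u_yx \<xi>' \<eta>'" if h: "0 < h" "v + h \<in> Y" for h
  proof -
    have Y: "w \<in> Y" if "v \<le> w" "w \<le> v + h" for w
      using that h assms Y_interval by (meson is_interval_1)
    define \<Delta> where "\<Delta> = (u (x + h) (v + h) - u (x + h) v) - (u x (v + h) - u x v)"
    have "\<exists>\<xi>>x. \<xi> < x + h \<and> (u (x + h) (v + h) - u (x + h) v) - (u x (v + h) - u x v) =
        (x + h - x) * (u_x \<xi> (v + h) - u_x \<xi> v)"
      using assms h Y by (intro MVT2 DERIV_diff has_u_x_at) auto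
    then obtain \<xi> where \<xi>: "x < \<xi>" "\<xi> < x + h" "\<Delta> = h * (u_x \<xi> (v + h) - u_x \<xi> v)"
      by (auto simp: \<Delta>_def)
    have "\<exists>\<eta>>v. \<eta> < v + h \<and> u_x \<xi> (v + h) - u_x \<xi> v = (v + h - v) * u_xy \<xi> \<eta>"
      using assms h Y \<xi> by (intro MVT2 has_u_xy) auto
    then obtain \<eta> where \<eta>: "v < \<eta>" "\<eta> < v + h" "u_x \<xi> (v + h) - u_x \<xi> v = h * u_xy \<xi> \<eta>"
      by auto
    have "\<exists>\<eta>>v. \<eta> < v + h \<and> (u (x + h) (v + h) - u x (v + h)) - (u (x + h) v - u x v) =
        (v + h - v) * (u_y (x + h) \<eta> - u_y x \<eta>)"
      using assms h Y by (intro MVT2 DERIV_diff has_u_y) auto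
    then obtain \<eta>' where \<eta>': "v < \<eta>'" "\<eta>' < v + h" "\<Delta> = h * (u_y (x + h) \<eta>' - u_y x \<eta>')"
      by (auto simp: \<Delta>_def)
    have "\<exists>\<xi>>x. \<xi> < x + h \<and> u_y (x + h) \<eta>' - u_y x \<eta>' = (x + h - x) * u_yx \<xi> \<eta>'"
      using assms h Y \<eta>' by (intro MVT2 has_u_yx_at) auto
    then obtain \<xi>' where \<xi>': "x < \<xi>'" "\<xi>' < x + h" "u_y (x + h) \<eta>' - u_y x \<eta>' = h * u_yx \<xi>' \<eta>'"
      by auto
    have "u_xy \<xi> \<eta> = u_yx \<xi>' \<eta>'" using \<xi>(3) \<eta>(3) \<eta>'(3) \<xi>'(3) h by simp
    then show ?thesis
      using \<xi> \<eta> \<xi>' \<eta>' by (intro exI[of _ \<xi>] exI[of _ \<eta>] exI[of _ \<xi>'] exI[of _ \<eta>']) auto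
  qed
  have "((\<lambda>h. v + h) \<longlongrightarrow> v) (at_right 0)" by (auto intro!: tendsto_eq_intros)
  then have "\<forall>\<^sub>F h in at_right 0. v + h \<in> Y"
    using Y_open assms(2) by (rule topological_tendstoD)
  then have "\<forall>\<^sub>F h in at_right 0. \<exists>\<xi> \<eta> \<xi>' \<eta>'. \<xi> \<in> {x..x + h} \<and> \<eta> \<in> {v..v + h} \<and>
      \<xi>' \<in> {x..x + h} \<and> \<eta>' \<in> {v..v + h} \<and> u_xy \<xi> \<eta> = u_yx \<xi>' \<eta>'"
    using eventually_at_right_less[of "0::real"] by eventually_elim (use square in blast)
  then obtain \<xi> \<eta> \<xi>' \<eta>' where *: "\<forall>\<^sub>F h in at_right 0. \<xi> h \<in> {x..x + h} \<and> \<eta> h \<in> {v..v + h} \<and>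
      \<xi>' h \<in> {x..x + h} \<and> \<eta>' h \<in> {v..v + h} \<and> u_xy (\<xi> h) (\<eta> h) = u_yx (\<xi>' h) (\<eta>' h)"
    unfolding eventually_ex by blast
  have squeeze: "(k \<longlongrightarrow> a) (at_right 0)" if "\<forall>\<^sub>F h in at_right 0. k h \<in> {a..a + h}" for k and a :: real
  proof (rule tendsto_sandwich[of "\<lambda>_. a" _ _ "\<lambda>h. a + h"])
    show "((\<lambda>h. a + h) \<longlongrightarrow> a) (at_right 0)" by (auto intro!: tendsto_eq_intros)
  qed (use that in \<open>auto elim!: eventually_mono\<close>)
  have lims: "(\<xi> \<longlongrightarrow> x) (at_right 0)" "(\<eta> \<longlongrightarrow> v) (at_right 0)" "(\<xi>' \<longlongrightarrow> x) (at_right 0)" "(\<eta>' \<longlongrightarrow> v) (at_right 0)"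
    using * by (auto intro!: squeeze elim!: eventually_mono)
  have "((\<lambda>h. u_xy (\<xi> h) (\<eta> h)) \<longlongrightarrow> u_xy x v) (at_right 0)"
    by (rule partial_tendsto) (use lims assms in auto)
  moreover have "((\<lambda>h. u_yx (\<xi>' h) (\<eta>' h)) \<longlongrightarrow> u_yx x v) (at_right 0)"
    by (rule partial_tendsto) (use lims assms in auto)
  then have "((\<lambda>h. u_xy (\<xi> h) (\<eta> h)) \<longlongrightarrow> u_yx x v) (at_right 0)"
    by (rule Lim_transform_eventually) (use * in \<open>auto elim!: eventually_mono\<close>)
  ultimately show ?thesis
    using tendsto_unique[OF trivial_limit_at_right_real] by blast
qed

lemma u_y_strict_mono_x:
  assumes "0 < x" "x < z" "v \<in> Y"
  shows "u_y x v < u_y z v"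
proof (rule DERIV_pos_imp_increasing[OF assms(2)])
  fix t assume "x \<le> t" "t \<le> z"
  then have t: "0 < t" using assms by simp
  then show "\<exists>y. ((\<lambda>t. u_y t v) has_real_derivative y) (at t) \<and> 0 < y"
    using has_u_yx_at[of t v] u_xy_pos[of t v] mixed_partials_eq[of t v] assms t by auto
qed

section \<open>Best response to a load\<close>

text \<open>A load is the marginal cost, at own consumption \<open>x\<close>, of lagging behind fixed targets.\<close>

definition load :: "(real \<Rightarrow> real) \<Rightarrow> bool" where
  "load \<psi> \<longleftrightarrow> continuous_on UNIV \<psi> \<and> antimono \<psi> \<and> (\<forall>x. 0 \<le> \<psi> x) \<and> (\<exists>t. \<forall>x\<ge>t. \<psi> x = 0)"

lemma load_mcost:
  assumes "0 \<le> c"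
  shows "load (\<lambda>x. c * mcost (t - x))"
  unfolding load_def
proof (intro conjI)
  show "continuous_on UNIV (\<lambda>x. c * mcost (t - x))"
    by (intro continuous_intros continuous_on_compose2[OF mcost_continuous]) auto
  show "antimono (\<lambda>x. c * mcost (t - x))"
    using assms by (intro antimonoI mult_left_mono mcost_mono) auto
  show "\<exists>t'. \<forall>x\<ge>t'. c * mcost (t - x) = 0"
    by (rule exI[of _ t]) simp
qed (use assms mcost_nonneg in simp)

lemma load_add:
  assumes "load \<phi>" "load \<psi>"
  shows "load (\<lambda>x. \<phi> x + \<psi> x)"
proof -
  obtain s t where "\<forall>x\<ge>s. \<phi> x = 0" "\<forall>x\<ge>t. \<psi> x = 0" using assms unfolding load_def by blast
  then have "\<forall>x\<ge>max s t. \<phi> x + \<psi> x = 0" by simp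
  then show ?thesis
    using assms unfolding load_def
    by (intro conjI exI[of _ "max s t"]) (auto intro!: continuous_intros simp: antimono_def add_mono)
qed

definition response :: "(real \<Rightarrow> real) \<Rightarrow> real \<Rightarrow> real" where
  "response \<psi> v = (THE x. 0 \<le> x \<and> u_x x v + \<psi> x = 0)"

context
  fixes \<psi> :: "real \<Rightarrow> real" and v :: real
  assumes load: "load \<psi>" and v: "v \<in> Y"
begin

lemma marginal_strict_anti: "0 \<le> x \<Longrightarrow> x < z \<Longrightarrow> u_x z v + \<psi> z < u_x x v + \<psi> x"
  using load u_x_strict_anti[OF v, of x z] by (intro add_less_le_mono) (auto simp: load_def antimono_def)

lemma response_unique:
  assumes "0 \<le> x" "u_x x v + \<psi> x = 0"
  shows "response \<psi> v = x"
  unfolding response_def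
proof (rule the_equality)
  fix z assume "0 \<le> z \<and> u_x z v + \<psi> z = 0"
  then show "z = x"
    using marginal_strict_anti[of x z] marginal_strict_anti[of z x] assms
    by (cases x z rule: linorder_cases) auto
qed (use assms in simp)

text \<open>Intermediate value theorem: at the autarkic optimum \<open>u_x\<close> vanishes and the
  load is nonnegative, while far enough to the right the load vanishes and \<open>u_x\<close> is at
  most 0.\<close>

lemma response_props: "x_a u v \<le> response \<psi> v" "u_x (response \<psi> v) v + \<psi> (response \<psi> v) = 0"
proof -
  obtain t where t: "\<forall>x\<ge>t. \<psi> x = 0" using load unfolding load_def by blast
  define b where "b = max t (x_a u v)"
  have "continuous_on {0..} (\<lambda>x. u_x x v)"
    using has_u_xx[OF _ v] by (auto intro!: DERIV_continuous_on)
  then have "continuous_on {x_a u v..b} (\<lambda>x. u_x x v + \<psi> x)"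
    using load x_a_interior[OF v] unfolding load_def
    by (intro continuous_intros) (auto elim!: continuous_on_subset)
  moreover have "u_x b v + \<psi> b \<le> 0"
    using u_x_strict_anti[OF v, of "x_a u v" b] x_a_foc[OF v] x_a_interior[OF v] t
    by (cases "x_a u v < t") (auto simp: b_def max_def)
  moreover have "0 \<le> u_x (x_a u v) v + \<psi> (x_a u v)"
    using x_a_foc[OF v] load by (simp add: load_def)
  ultimately obtain x where x: "x_a u v \<le> x" "u_x x v + \<psi> x = 0"
    using IVT2'[of "\<lambda>x. u_x x v + \<psi> x" b 0 "x_a u v"] by (auto simp: b_def)
  then have "response \<psi> v = x" using x_a_interior[OF v] by (intro response_unique) auto
  then show "x_a u v \<le> response \<psi> v" "u_x (response \<psi> v) v + \<psi> (response \<psi> v) = 0"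
    using x by simp_all
qed

lemma response_pos: "0 < response \<psi> v"
  using response_props(1) x_a_interior[OF v] by simp

lemma response_less: "0 \<le> t \<Longrightarrow> u_x t v + \<psi> t < 0 \<Longrightarrow> response \<psi> v < t"
  using marginal_strict_anti[of t "response \<psi> v"] response_props(2)
  by (cases t "response \<psi> v" rule: linorder_cases) auto

end

text \<open>Load and income may vary together along any filter, so the same fact gives continuity of
  consumption in mobility and in integration.\<close>

lemma response_tendsto:
  assumes "\<forall>\<^sub>F s in \<F>. load (\<psi> s)" "load \<psi>0" "\<And>x. ((\<lambda>s. \<psi> s x) \<longlongrightarrow> \<psi>0 x) \<F>"
    and v: "(v \<longlongrightarrow> v0) \<F>" "v0 \<in> Y"
  shows "((\<lambda>s. response (\<psi> s) (v s)) \<longlongrightarrow> response \<psi>0 v0) \<F>"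
proof (rule root_tendsto[where g = "\<lambda>s x. u_x x (v s) + \<psi> s x" and ?g0.0 = "\<lambda>x. u_x x v0 + \<psi>0 x"])
  have Y: "\<forall>\<^sub>F s in \<F>. v s \<in> Y" using topological_tendstoD[OF v(1) Y_open v(2)] .
  show "\<forall>\<^sub>F s in \<F>. 0 \<le> response (\<psi> s) (v s) \<and>
      u_x (response (\<psi> s) (v s)) (v s) + \<psi> s (response (\<psi> s) (v s)) = 0"
    using assms(1) Y by eventually_elim (use response_props response_pos in \<open>force intro: less_imp_le\<close>)
  show "\<forall>\<^sub>F s in \<F>. \<forall>x x'. 0 \<le> x \<longrightarrow> x < x' \<longrightarrow> u_x x' (v s) + \<psi> s x' < u_x x (v s) + \<psi> s x"
    using assms(1) Y by eventually_elim (use marginal_strict_anti in blast)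
  fix x :: real assume x: "0 \<le> x"
  have "isCont (u_x x) v0" by (rule DERIV_isCont[OF has_u_xy[OF x v(2)]])
  then show "((\<lambda>s. u_x x (v s) + \<psi> s x) \<longlongrightarrow> u_x x v0 + \<psi>0 x) \<F>"
    by (intro tendsto_add assms(3) isCont_tendsto_compose[OF _ v(1)])
qed (use response_pos response_props marginal_strict_anti assms in auto)

lemma x_a_eq_response: "v \<in> Y \<Longrightarrow> x_a u v = response (\<lambda>_. 0) v"
  using x_a_foc x_a_interior
  by (intro response_unique[symmetric]) (auto simp: load_def antimono_def intro!: less_imp_le)

section \<open>First-order conditions and uniqueness of the equilibrium\<close>

lemma payoff_eq:
  "payoff u F G e x i = u (x $ i) (e i) - (\<Sum>j\<in>UNIV. G $ i $ j * cost (x $ j - x $ i))"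
proof -
  have "(\<Sum>j | x $ i \<le> x $ j. G $ i $ j * F (x $ j - x $ i)) =
      (\<Sum>j | x $ i \<le> x $ j. G $ i $ j * cost (x $ j - x $ i))"
    by (intro sum.cong) (auto simp: cost_def)
  also have "\<dots> = (\<Sum>j\<in>UNIV. G $ i $ j * cost (x $ j - x $ i))"
    by (intro sum.mono_neutral_left) auto
  finally show ?thesis by (simp add: payoff_def)
qed

lemma payoff_deviation:
  assumes "G $ i $ i = 0"
  shows "payoff u F G e (\<chi> j. if j = i then z else x $ j) i =
    u z (e i) - (\<Sum>j\<in>UNIV. G $ i $ j * cost (x $ j - z))"
proof -
  have "(\<Sum>j\<in>UNIV. G $ i $ j * cost ((\<chi> j. if j = i then z else x $ j) $ j - z)) =
      (\<Sum>j\<in>UNIV. G $ i $ j * cost (x $ j - z))"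
    using assms by (intro sum.cong) auto
  then show ?thesis by (simp add: payoff_eq)
qed

definition foc :: "real ^ 'n ^ 'n \<Rightarrow> ('n::finite \<Rightarrow> real) \<Rightarrow> real ^ 'n \<Rightarrow> bool" where
  "foc G e x \<longleftrightarrow> (\<forall>i. 0 \<le> x $ i \<and>
     u_x (x $ i) (e i) + (\<Sum>j\<in>UNIV. G $ i $ j * mcost (x $ j - x $ i)) = 0)"

context
  fixes G :: "real ^ 'n ^ 'n" and e :: "'n::finite \<Rightarrow> real"
  assumes G_nonneg: "\<And>i j. 0 \<le> G $ i $ j" and G_diag: "\<And>i. G $ i $ i = 0"
    and e: "\<And>i. e i \<in> Y"
begin

lemma deviation_deriv:
  assumes "0 \<le> z"
  shows "((\<lambda>z. u z (e i) - (\<Sum>j\<in>UNIV. G $ i $ j * cost (x $ j - z))) has_real_derivative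
    u_x z (e i) + (\<Sum>j\<in>UNIV. G $ i $ j * mcost (x $ j - z))) (at z within {0..})"
proof -
  have "((\<lambda>z. G $ i $ j * cost (x $ j - z)) has_real_derivative G $ i $ j * (mcost (x $ j - z) * (0 - 1)))
      (at z within {0..})" for j
    by (intro DERIV_cmult DERIV_chain2[OF cost_deriv] DERIV_diff DERIV_const DERIV_ident)
  then have "((\<lambda>z. u z (e i) - (\<Sum>j\<in>UNIV. G $ i $ j * cost (x $ j - z))) has_real_derivative
      u_x z (e i) - (\<Sum>j\<in>UNIV. G $ i $ j * (mcost (x $ j - z) * (0 - 1)))) (at z within {0..})"
    by (intro DERIV_diff DERIV_sum has_u_x assms e)
  then show ?thesis by (simp add: sum_negf)
qed

lemma deviation_marginal_strict_anti:
  assumes "0 \<le> z" "z < z'"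
  shows "u_x z' (e i) + (\<Sum>j\<in>UNIV. G $ i $ j * mcost (x $ j - z')) <
    u_x z (e i) + (\<Sum>j\<in>UNIV. G $ i $ j * mcost (x $ j - z))"
  using assms
  by (intro add_less_le_mono u_x_strict_anti e sum_mono mult_left_mono mcost_mono G_nonneg) auto

text \<open>The marginal payoff of a unilateral deviation is strictly decreasing, so a zero of it is
  a global maximum.\<close>

lemma nash_if_foc:
  assumes "foc G e x"
  shows "nash_equilibrium u F G e x"
  unfolding nash_equilibrium_def
proof (intro conjI allI impI)
  show "0 \<le> x $ i" for i using assms by (simp add: foc_def)
  fix i and z :: real assume z: "0 \<le> z"
  define h where "h z = u z (e i) - (\<Sum>j\<in>UNIV. G $ i $ j * cost (x $ j - z))" for z
  define h' where "h' z = u_x z (e i) + (\<Sum>j\<in>UNIV. G $ i $ j * mcost (x $ j - z))" for z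
  have h: "(h has_real_derivative h' z) (at z within {0..})" if "0 \<le> z" for z
    using deviation_deriv[OF that] unfolding h_def h'_def .
  have anti: "h' z' < h' z" if "0 \<le> z" "z < z'" for z z'
    using deviation_marginal_strict_anti[OF that] unfolding h'_def .
  have x: "0 \<le> x $ i" "h' (x $ i) = 0" using assms unfolding foc_def h'_def by auto
  have mvt: "\<exists>\<xi>\<in>{a<..<b}. h b - h a = h' \<xi> * (b - a)" if "0 \<le> a" "a < b" for a b
    using that
    by (intro mvt_simple) (auto intro!: has_field_derivative_subset[OF h]
        simp flip: has_field_derivative_def)
  have "h z \<le> h (x $ i)"
  proof (cases z "x $ i" rule: linorder_cases)
    case less
    then obtain \<xi> where \<xi>: "\<xi> \<in> {z<..<x $ i}" "h (x $ i) - h z = h' \<xi> * (x $ i - z)"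
      using mvt z by blast
    have "0 \<le> h' \<xi> * (x $ i - z)" using anti[of \<xi> "x $ i"] x z \<xi>(1) by auto
    then show ?thesis using \<xi>(2) by simp
  next
    case greater
    then obtain \<xi> where \<xi>: "\<xi> \<in> {x $ i<..<z}" "h z - h (x $ i) = h' \<xi> * (z - x $ i)"
      using mvt x by blast
    have "h' \<xi> * (z - x $ i) \<le> 0" using anti[of "x $ i" \<xi>] x z \<xi>(1)
      by (intro mult_nonpos_nonneg) auto
    then show ?thesis using \<xi>(2) by simp
  qed simp
  then show "payoff u F G e (\<chi> j. if j = i then z else x $ j) i \<le> payoff u F G e x i"
    unfolding payoff_deviation[OF G_diag] payoff_eq[of G e x] h_def .
qed

lemma foc_if_nash:
  assumes "nash_equilibrium u F G e x"
  shows "foc G e x"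
  unfolding foc_def
proof (intro allI conjI)
  fix i
  define h where "h z = u z (e i) - (\<Sum>j\<in>UNIV. G $ i $ j * cost (x $ j - z))" for z
  define h' where "h' z = u_x z (e i) + (\<Sum>j\<in>UNIV. G $ i $ j * mcost (x $ j - z))" for z
  show x: "0 \<le> x $ i" using assms by (simp add: nash_equilibrium_def)
  have h: "(h has_real_derivative h' (x $ i)) (at (x $ i) within {0..})"
    using deviation_deriv[OF x] unfolding h_def h'_def .
  have max: "h z \<le> h (x $ i)" if "0 \<le> z" for z
    using assms that
    unfolding nash_equilibrium_def payoff_deviation[OF G_diag] payoff_eq[of G e x] h_def by blast
  have "\<not> 0 < h' (x $ i)"
  proof
    assume "0 < h' (x $ i)"
    then obtain d where "0 < d" "\<forall>k>0. x $ i + k \<in> {0..} \<longrightarrow> k < d \<longrightarrow> h (x $ i) < h (x $ i + k)"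
      using has_real_derivative_pos_inc_right[OF h] by auto
    then show False using max[of "x $ i + d / 2"] x by (auto dest!: spec[of _ "d / 2"])
  qed
  moreover have "\<not> h' (x $ i) < 0"
  proof
    assume neg: "h' (x $ i) < 0"
    \<comment> \<open>Interiority of the autarkic optimum makes marginal utility positive at 0, so a
      negative marginal payoff can only occur at positive consumption, where a downward deviation is
      feasible.\<close>
    have "0 < u_x 0 (e i)"
      using u_x_strict_anti[OF e, of 0 "x_a u (e i)" i] x_a_foc[OF e, of i] x_a_interior[OF e, of i]
      by simp
    moreover have "0 \<le> (\<Sum>j\<in>UNIV. G $ i $ j * mcost (x $ j - x $ i))"
      by (intro sum_nonneg mult_nonneg_nonneg G_nonneg mcost_nonneg)
    ultimately have "x $ i \<noteq> 0" using neg unfolding h'_def by auto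
    then have pos: "0 < x $ i" using x by simp
    obtain d where "0 < d" "\<forall>k>0. x $ i - k \<in> {0..} \<longrightarrow> k < d \<longrightarrow> h (x $ i) < h (x $ i - k)"
      using has_real_derivative_neg_dec_left[OF h neg] by auto
    \<comment> \<open>The minimum keeps the deviation nonnegative.\<close>
    then show False using max[of "x $ i - min (d / 2) (x $ i)"] pos
      by (auto dest!: spec[of _ "min (d / 2) (x $ i)"])
  qed
  ultimately show "u_x (x $ i) (e i) + (\<Sum>j\<in>UNIV. G $ i $ j * mcost (x $ j - x $ i)) = 0"
    unfolding h'_def by simp
qed

text \<open>At an agent maximizing \<open>x $ i - z $ i\<close> every gap to a target is weakly smaller under \<open>x\<close>,
  so the first-order condition forces \<open>x $ i \<le> z $ i\<close>.\<close>

lemma foc_le: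
  assumes "foc G e x" "foc G e z"
  shows "x $ k \<le> z $ k"
proof -
  let ?gaps = "range (\<lambda>i. x $ i - z $ i)"
  have "Max ?gaps \<in> ?gaps" by (rule Max_in) auto
  then obtain i where "Max ?gaps = x $ i - z $ i" by blast
  moreover have "x $ j - z $ j \<le> Max ?gaps" for j by (rule Max_ge) auto
  ultimately have i: "x $ j - z $ j \<le> x $ i - z $ i" for j by simp
  have "\<not> z $ i < x $ i"
  proof
    assume less: "z $ i < x $ i"
    have "u_x (x $ i) (e i) < u_x (z $ i) (e i)"
      using less assms(2) by (intro u_x_strict_anti e) (auto simp: foc_def)
    moreover have "(\<Sum>j\<in>UNIV. G $ i $ j * mcost (x $ j - x $ i)) \<le> (\<Sum>j\<in>UNIV. G $ i $ j * mcost (z $ j - z $ i))"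
      using i by (intro sum_mono mult_left_mono mcost_mono G_nonneg) (simp add: algebra_simps)
    moreover have "u_x (x $ i) (e i) + (\<Sum>j\<in>UNIV. G $ i $ j * mcost (x $ j - x $ i)) = 0"
        "u_x (z $ i) (e i) + (\<Sum>j\<in>UNIV. G $ i $ j * mcost (z $ j - z $ i)) = 0"
      using assms unfolding foc_def by blast+
    ultimately show False by linarith
  qed
  then show ?thesis using i[of k] by simp
qed

text \<open>Applying \<open>foc_le\<close> in both directions gives uniqueness, so the definite
  description is evaluated by exhibiting one solution.\<close>

lemma equilibrium_eqI:
  assumes "foc G e x"
  shows "equilibrium u F G e = x"
  unfolding equilibrium_def
proof (rule the_equality)
  show "nash_equilibrium u F G e x" by (rule nash_if_foc[OF assms])
  fix z assume "nash_equilibrium u F G e z"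
  then have "foc G e z" by (rule foc_if_nash)
  then show "z = x" using foc_le assms by (simp add: vec_eq_iff order_antisym)
qed

end

end

section \<open>Reduction to the four classes\<close>

lemma UNIV_agent_class:
  "(UNIV :: agent_class set) = {(High, Rich), (High, Poor), (Low, Rich), (Low, Poor)}"
proof -
  have "a = High \<or> a = Low" "b = Rich \<or> b = Poor" for a b
    by (cases a; simp) (cases b; simp)
  then show ?thesis by force
qed

lemma sum_by_class:
  fixes cls :: "'n::finite \<Rightarrow> agent_class" and h :: "'n \<Rightarrow> real"
  shows "(\<Sum>j\<in>UNIV. h j) = (\<Sum>q\<in>UNIV. \<Sum>j | cls j = q. h j)"
proof -
  have "finite (UNIV :: agent_class set)" by (simp add: UNIV_agent_class)
  from sum.group[OF finite[of "UNIV :: 'n set"] this subset_UNIV, where g = cls and h = h] show ?thesis by simp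
qed

lemma network_sum:
  fixes cls :: "'n::finite \<Rightarrow> agent_class"
  assumes "network cls d \<omega> \<rho> G"
  shows "(\<Sum>j\<in>UNIV. G $ i $ j * h (cls j)) = (\<Sum>q\<in>UNIV. d * link_share \<omega> \<rho> (cls i) q * h q)"
proof -
  have "(\<Sum>j | cls j = q. G $ i $ j * h (cls j)) = d * link_share \<omega> \<rho> (cls i) q * h q" for q
  proof -
    have "(\<Sum>j | cls j = q. G $ i $ j * h (cls j)) = (\<Sum>j | cls j = q. G $ i $ j) * h q"
      by (simp add: sum_distrib_right)
    moreover have "(\<Sum>j | cls j = q. G $ i $ j) = d * link_share \<omega> \<rho> (cls i) q"
      using assms unfolding network_def by blast
    ultimately show ?thesis by simp
  qed
  then show ?thesis by (simp add: sum_by_class[of _ cls])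
qed

context status_game
begin

lemma class_equilibrium:
  fixes cls :: "'n::finite \<Rightarrow> agent_class"
  assumes G: "network cls d \<omega> \<rho> G" and y: "\<And>q. y q \<in> Y"
    and X: "\<And>q. 0 \<le> X q \<and>
      u_x (X q) (y q) + (\<Sum>q'\<in>UNIV. d * link_share \<omega> \<rho> q q' * mcost (X q' - X q)) = 0"
  shows "equilibrium_payoffs u F G (\<lambda>i. y (cls i)) =
    (\<chi> i. u (X (cls i)) (y (cls i)) -
      (\<Sum>q'\<in>UNIV. d * link_share \<omega> \<rho> (cls i) q' * cost (X q' - X (cls i))))"
proof -
  have "foc G (\<lambda>i. y (cls i)) (\<chi> i. X (cls i))"
    using X by (simp add: foc_def network_sum[OF G, of _ "\<lambda>q. mcost (X q - _)"])
  then have "equilibrium u F G (\<lambda>i. y (cls i)) = (\<chi> i. X (cls i))"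
    using G y by (intro equilibrium_eqI) (auto simp: network_def)
  then show ?thesis
    by (simp add: equilibrium_payoffs_def payoff_eq network_sum[OF G, of _ "\<lambda>q. cost (X q - _)"])
qed

section \<open>A class lagging behind one target\<close>

text \<open>Here \<open>t\<close> is the target, \<open>c\<close> the link intensity and
  \<open>v\<close> the income. A middle class behaves this way: its other links lead to equals or to
  the class below it, which cost nothing. Intensity 0 is autarky.\<close>

definition follow :: "real \<Rightarrow> real \<Rightarrow> real \<Rightarrow> real" where
  "follow t c v = response (\<lambda>x. c * mcost (t - x)) v"

definition follow_utility :: "real \<Rightarrow> real \<Rightarrow> real \<Rightarrow> real" where
  "follow_utility t c v = u (follow t c v) v - c * cost (t - follow t c v)"

definition follow_slope :: "real \<Rightarrow> real \<Rightarrow> real \<Rightarrow> real" where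
  "follow_slope t c v =
     u_xy (follow t c v) v / (c * f' (t - follow t c v) - u_xx (follow t c v) v)"

lemma follow_pos: "0 \<le> c \<Longrightarrow> v \<in> Y \<Longrightarrow> 0 < follow t c v"
  unfolding follow_def by (intro response_pos load_mcost)

lemma follow_foc: "0 \<le> c \<Longrightarrow> v \<in> Y \<Longrightarrow> u_x (follow t c v) v + c * mcost (t - follow t c v) = 0"
  unfolding follow_def by (intro response_props load_mcost)

lemma follow_less: "0 \<le> c \<Longrightarrow> v \<in> Y \<Longrightarrow> 0 \<le> t \<Longrightarrow> u_x t v < 0 \<Longrightarrow> follow t c v < t"
  unfolding follow_def by (intro response_less load_mcost) simp_all

lemma follow_zero: "v \<in> Y \<Longrightarrow> follow t 0 v = x_a u v"
  by (simp add: follow_def x_a_eq_response)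

lemma follow_utility_zero: "v \<in> Y \<Longrightarrow> follow_utility t 0 v = V u v"
  by (simp add: follow_utility_def V_def follow_zero)

text \<open>At or below the autarkic optimum marginal utility is nonnegative and the strictly
  positive marginal cost of lagging is added, so the first-order condition fails.\<close>

lemma follow_gt_x_a:
  assumes "0 < c" "v \<in> Y" "0 \<le> t" "u_x t v < 0"
  shows "x_a u v < follow t c v"
proof (rule ccontr)
  assume "\<not> x_a u v < follow t c v"
  then have "0 \<le> u_x (follow t c v) v"
    using u_x_strict_anti[of v "follow t c v" "x_a u v"] x_a_foc[of v] follow_pos[of c v t] assms
    by (cases "follow t c v = x_a u v") auto
  moreover have "0 < c * mcost (t - follow t c v)"
    using assms by (intro mult_pos_pos mcost_pos) (simp_all add: follow_less)
  ultimately show False using follow_foc[of c v t] assms by simp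
qed

lemma follow_tendsto:
  assumes c: "(c \<longlongrightarrow> c0) \<F>" "\<forall>\<^sub>F s in \<F>. 0 \<le> c s" "0 \<le> c0"
    and v: "(v \<longlongrightarrow> v0) \<F>" "v0 \<in> Y"
  shows "((\<lambda>s. follow t (c s) (v s)) \<longlongrightarrow> follow t c0 v0) \<F>"
  unfolding follow_def
proof (rule response_tendsto)
  show "\<forall>\<^sub>F s in \<F>. load (\<lambda>x. c s * mcost (t - x))"
    using c(2) by eventually_elim (rule load_mcost)
qed (use c v in \<open>auto intro!: load_mcost tendsto_intros\<close>)

lemma follow_slope_denominator:
  assumes "0 \<le> c" "v \<in> Y" "0 \<le> t" "u_x t v < 0"
  shows "- u_xx (follow t c v) v \<le> c * f' (t - follow t c v) - u_xx (follow t c v) v"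
    "0 < - u_xx (follow t c v) v"
  using f'_nonneg[of "t - follow t c v"] follow_less[OF assms] u_xx_neg[of "follow t c v" v]
    follow_pos[of c v t] assms by simp_all

text \<open>Dropping the nonnegative term with \<open>f'\<close> from the denominator gives the
  upper bound, which will control how far the target of the bottom class moves.\<close>

lemma follow_slope_bounds:
  assumes "0 \<le> c" "v \<in> Y" "0 \<le> t" "u_x t v < 0"
  shows "0 \<le> follow_slope t c v" "follow_slope t c v \<le> u_xy (follow t c v) v / (- u_xx (follow t c v) v)"
proof -
  have "0 \<le> u_xy (follow t c v) v"
    using u_xy_pos[of "follow t c v" v] follow_pos[of c v t] assms by simp
  then show "0 \<le> follow_slope t c v" "follow_slope t c v \<le> u_xy (follow t c v) v / (- u_xx (follow t c v) v)"
    unfolding follow_slope_def using follow_slope_denominator[OF assms]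
    by (auto intro!: divide_nonneg_pos divide_left_mono mult_pos_pos simp del: divide_minus_right)
qed

lemma eventually_in_Y:
  assumes "v \<in> Y"
  shows "\<forall>\<^sub>F w in at v. w \<in> Y"
  using Y_open assms by (auto simp: eventually_at_filter elim!: eventually_mono dest: eventually_nhds_in_open)

lemma follow_deriv:
  assumes "0 \<le> c" "v \<in> Y" "0 \<le> t" "u_x t v < 0"
  shows "(follow t c has_real_derivative follow_slope t c v) (at v)"
proof -
  let ?X = "follow t c" and ?x = "follow t c v"
  let ?g = "\<lambda>x w. u_x x w + c * mcost (t - x)"
  have X: "(?X \<longlongrightarrow> ?x) (at v)"
    using assms by (intro follow_tendsto) auto
  have pos: "0 < ?x" and less: "?x < t" using assms follow_pos follow_less by auto
  have "(?X has_real_derivative - u_xy ?x v / (u_xx ?x v - c * f' (t - ?x))) (at v)"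
  proof (rule implicit_derivative[where g = ?g and gx = "\<lambda>x w. u_xx x w - c * f' (t - x)"])
    show "\<forall>\<^sub>F w in at v. ?g (?X w) w = 0"
      using eventually_in_Y[OF assms(2)] by eventually_elim (use assms follow_foc in auto)
    show "((\<lambda>w. ?g ?x w) has_real_derivative u_xy ?x v) (at v)"
      using has_u_xy[of ?x v] pos assms by (auto intro!: derivative_eq_intros)
    show "\<forall>\<^sub>F w in at v. \<forall>x\<in>closed_segment ?x (?X w).
        ((\<lambda>x. ?g x w) has_real_derivative u_xx x w - c * f' (t - x)) (at x)"
      using eventually_in_Y[OF assms(2)] order_tendstoD(2)[OF X less]
    proof eventually_elim
      case (elim w)
      show ?case
      proof
        fix x assume "x \<in> closed_segment ?x (?X w)"
        then have x: "0 < x" "x < t"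
          using pos less follow_pos[of c w t] elim assms
          by (auto simp: closed_segment_eq_real_ivl split: if_splits)
        have "((\<lambda>x. mcost (t - x)) has_real_derivative f' (t - x) * (0 - 1)) (at x)"
          using x by (intro DERIV_chain2[OF mcost_deriv] DERIV_diff DERIV_const DERIV_ident) simp
        from DERIV_add[OF has_u_xx_at[OF x(1) elim(1)] DERIV_cmult[OF this, of c]]
        show "((\<lambda>x. ?g x w) has_real_derivative u_xx x w - c * f' (t - x)) (at x)" by simp
      qed
    qed
    show "((\<lambda>w. u_xx (\<xi> w) w - c * f' (t - \<xi> w)) \<longlongrightarrow> u_xx ?x v - c * f' (t - ?x)) (at v)"
      if \<xi>: "(\<xi> \<longlongrightarrow> ?x) (at v)" for \<xi>
    proof (intro tendsto_diff tendsto_mult tendsto_const f'_tendsto \<xi>)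
      show "((\<lambda>w. u_xx (\<xi> w) w) \<longlongrightarrow> u_xx ?x v) (at v)"
        by (rule partial_tendsto) (use \<xi> pos assms in auto)
    qed (use less in simp)
    show "u_xx ?x v - c * f' (t - ?x) \<noteq> 0" using follow_slope_denominator[OF assms] by simp
  qed (use X assms follow_foc in auto)
  moreover have "- u_xy ?x v / (u_xx ?x v - c * f' (t - ?x)) = follow_slope t c v"
    unfolding follow_slope_def by (metis minus_diff_eq minus_divide_divide minus_minus)
  ultimately show ?thesis by simp
qed

text \<open>Envelope theorem: the effect through the class's own consumption is multiplied by its
  first-order condition.\<close>

lemma follow_utility_deriv:
  assumes "0 \<le> c" "v \<in> Y" "0 \<le> t" "u_x t v < 0"
  shows "(follow_utility t c has_real_derivative u_y (follow t c v) v) (at v)"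
proof -
  let ?X = "follow t c" and ?x = "follow t c v"
  let ?h = "\<lambda>x w. u x w - c * cost (t - x)"
  have pos: "0 < ?x" using assms follow_pos by auto
  have X: "(?X \<longlongrightarrow> ?x) (at v)"
    using assms by (intro follow_tendsto) auto
  have "((\<lambda>w. ?h (?X w) w) has_real_derivative
      (u_x ?x v + c * mcost (t - ?x)) * follow_slope t c v + u_y ?x v) (at v)"
  proof (rule diagonal_derivative[where h = ?h and hv = u_y])
    have "((\<lambda>x. cost (t - x)) has_real_derivative mcost (t - ?x) * (0 - 1)) (at ?x)"
      by (intro DERIV_chain2[OF cost_deriv] DERIV_diff DERIV_const DERIV_ident)
    from DERIV_diff[OF has_u_x_at[OF pos assms(2)] DERIV_cmult[OF this, of c]]
    show "((\<lambda>x. ?h x v) has_real_derivative u_x ?x v + c * mcost (t - ?x)) (at ?x)" by simp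
    show "\<forall>\<^sub>F w in at v. \<forall>z\<in>closed_segment v w. (?h (?X w) has_real_derivative u_y (?X w) z) (at z)"
      using eventually_in_Y[OF assms(2)]
    proof eventually_elim
      case (elim w)
      show ?case
      proof
        fix z assume "z \<in> closed_segment v w"
        then have "z \<in> Y"
          using Y_interval elim assms(2) by (meson closed_segment_subset is_interval_convex_1 subsetD)
        then show "(?h (?X w) has_real_derivative u_y (?X w) z) (at z)"
          using has_u_y[of "?X w" z] follow_pos[of c w t] elim assms
          by (auto intro!: derivative_eq_intros)
      qed
    qed
    show "((\<lambda>w. u_y (?X w) (\<xi> w)) \<longlongrightarrow> u_y ?x v) (at v)" if "(\<xi> \<longlongrightarrow> v) (at v)" for \<xi>
      by (rule partial_tendsto) (use X that pos assms in auto)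
  qed (rule follow_deriv[OF assms])
  then show ?thesis using follow_foc[of c v t] assms by (simp add: follow_utility_def[abs_def])
qed

lemma follow_utility_less_V:
  assumes "0 < c" "v \<in> Y" "0 \<le> t" "u_x t v < 0"
  shows "follow_utility t c v < V u v"
proof -
  have "u (follow t c v) v \<le> V u v"
    using x_a_exists[of v] follow_pos[of c v t] assms by (simp add: V_def is_arg_max_linorder)
  moreover have "0 < c * cost (t - follow t c v)"
    using assms by (intro mult_pos_pos cost_pos) (simp_all add: follow_less)
  ultimately show ?thesis by (simp add: follow_utility_def)
qed

lemma V_mono:
  assumes "v \<in> Y" "w \<in> Y" "v \<le> w"
  shows "V u v \<le> V u w"
proof -
  have "V u v \<le> u (x_a u v) w"
    using u_strict_mono_v[of "x_a u v" v w] x_a_interior[of v] assms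
    by (cases "v = w") (auto simp: V_def)
  also have "\<dots> \<le> V u w"
    using x_a_exists[of w] x_a_interior[of v] assms by (simp add: V_def is_arg_max_linorder)
  finally show ?thesis .
qed

lemma V_deriv:
  assumes "v \<in> Y"
  shows "(V u has_real_derivative u_y (x_a u v) v) (at v)"
proof -
  \<comment> \<open>Any point beyond the optimum would do: at intensity 0 the target has no
    influence, it only has to satisfy the hypothesis \<open>u_x ?t v < 0\<close>.\<close>
  let ?t = "x_a u v + 1"
  have "u_x ?t v < 0" "0 \<le> ?t"
    using u_x_strict_anti[of v "x_a u v" ?t] x_a_foc[OF assms] x_a_interior[OF assms] assms by auto
  then have "(follow_utility ?t 0 has_real_derivative u_y (x_a u v) v) (at v)"
    using follow_utility_deriv[of 0 v ?t] assms by (simp add: follow_zero)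
  then show ?thesis
    by (rule has_field_derivative_transform_within_open[OF _ Y_open assms]) (rule follow_utility_zero)
qed

text \<open>Adding the tangent inequalities of the concave function \<open>V u\<close> at
  \<open>v\<close> and at \<open>w\<close> compares its slopes, which are \<open>u_y\<close> at the
  autarkic optima.\<close>

lemma V_deriv_anti:
  assumes "v \<in> Y" "w \<in> Y" "v \<le> w"
  shows "u_y (x_a u w) w \<le> u_y (x_a u v) v"
proof (cases "v = w")
  case False
  have "convex_on Y (\<lambda>v. - V u v)"
    using V_strictly_concave unfolding strictly_concave_on_def by (rule strictly_convex_on_imp_convex_on)
  then have tangent: "- u_y (x_a u a) a * (b - a) \<le> - V u b - - V u a" if "a \<in> Y" "b \<in> Y" for a b
  proof (rule convex_on_imp_above_tangent)
    show "((\<lambda>v. - V u v) has_real_derivative - u_y (x_a u a) a) (at a within Y)"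
      by (rule has_field_derivative_at_within[OF DERIV_minus[OF V_deriv[OF that(1)]]])
  qed (use that Y_open Y_interval in \<open>auto simp: interior_open is_interval_connected_1\<close>)
  have "0 \<le> (u_y (x_a u v) v - u_y (x_a u w) w) * (w - v)"
    using tangent[of v w] tangent[of w v] assms by (simp add: algebra_simps)
  then show ?thesis using False assms by (simp add: zero_le_mult_iff)
qed simp

section \<open>Comparison of the two middle classes\<close>

text \<open>The class whose earning potential is \<open>a\<close> lags behind the top with intensity \<open>p\<close>, the
  other middle class (earning potential \<open>b\<close>) with intensity \<open>q\<close>. A social planner satisfying
  Pigou-Dalton then favours shifting income from the latter to the former.\<close>

definition favours :: "real \<Rightarrow> real \<Rightarrow> real \<Rightarrow> real \<Rightarrow> real \<Rightarrow> bool" where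
  "favours t p q a b \<longleftrightarrow> follow_utility t p a < follow_utility t q b \<and>
     u_y (follow t q b) b < u_y (follow t p a) a"

text \<open>Both chains pass through autarky at income \<open>a\<close>: lagging costs utility and a
  lower income does not raise \<open>V u\<close>; overconsumption raises \<open>u_y\<close> and, by
  concavity, a lower income does not reduce it. The strict steps come from \<open>0 < p\<close>, so
  \<open>a = b\<close> is allowed.\<close>

lemma favours_poorer:
  assumes "0 < p" "a \<in> Y" "b \<in> Y" "0 \<le> t" "u_x t a < 0" "a \<le> b"
  shows "favours t p 0 a b"
  unfolding favours_def
proof
  show "follow_utility t p a < follow_utility t 0 b"
    using follow_utility_less_V[of p a t] V_mono[of a b] assms by (simp add: follow_utility_zero)
  have "u_y (x_a u a) a < u_y (follow t p a) a"
    using assms by (intro u_y_strict_mono_x follow_gt_x_a) (auto simp: x_a_interior)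
  then show "u_y (follow t 0 b) b < u_y (follow t p a) a"
    using V_deriv_anti[of a b] assms by (simp add: follow_zero)
qed

lemma follow_utility_tendsto:
  assumes "(c \<longlongrightarrow> c0) \<F>" "\<forall>\<^sub>F s in \<F>. 0 \<le> c s" "0 \<le> c0"
    and "(v \<longlongrightarrow> v0) \<F>" "v0 \<in> Y"
  shows "((\<lambda>s. follow_utility t (c s) (v s)) \<longlongrightarrow> follow_utility t c0 v0) \<F>"
    "((\<lambda>s. u_y (follow t (c s) (v s)) (v s)) \<longlongrightarrow> u_y (follow t c0 v0) v0) \<F>"
proof -
  note X = follow_tendsto[OF assms, of t]
  show "((\<lambda>s. u_y (follow t (c s) (v s)) (v s)) \<longlongrightarrow> u_y (follow t c0 v0) v0) \<F>"
    by (rule partial_tendsto) (use X assms follow_pos in auto)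
  have "((\<lambda>s. u (follow t (c s) (v s)) (v s)) \<longlongrightarrow> u (follow t c0 v0) v0) \<F>"
    by (rule partial_tendsto) (use X assms follow_pos in auto)
  then show "((\<lambda>s. follow_utility t (c s) (v s)) \<longlongrightarrow> follow_utility t c0 v0) \<F>"
    unfolding follow_utility_def by (intro tendsto_intros cost_tendsto X assms)
qed

text \<open>Used twice: with fixed intensities and moving incomes near \<open>s_y\<close>, and with
  fixed incomes and moving intensities as \<rho> tends to its limit.\<close>

lemma favours_eventually:
  assumes "favours t p0 q0 a0 b0"
    and p: "(p \<longlongrightarrow> p0) \<F>" "\<forall>\<^sub>F s in \<F>. 0 \<le> p s" "0 \<le> p0"
    and q: "(q \<longlongrightarrow> q0) \<F>" "\<forall>\<^sub>F s in \<F>. 0 \<le> q s" "0 \<le> q0"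
    and a: "(a \<longlongrightarrow> a0) \<F>" "a0 \<in> Y" and b: "(b \<longlongrightarrow> b0) \<F>" "b0 \<in> Y"
  shows "\<forall>\<^sub>F s in \<F>. favours t (p s) (q s) (a s) (b s)"
proof -
  note A = follow_utility_tendsto[OF p a, of t] and B = follow_utility_tendsto[OF q b, of t]
  have "\<forall>\<^sub>F s in \<F>. 0 < follow_utility t (q s) (b s) - follow_utility t (p s) (a s)"
    using assms(1) by (intro order_tendstoD(1)[OF tendsto_diff[OF B(1) A(1)]]) (simp add: favours_def)
  moreover have "\<forall>\<^sub>F s in \<F>. 0 < u_y (follow t (p s) (a s)) (a s) - u_y (follow t (q s) (b s)) (b s)"
    using assms(1) by (intro order_tendstoD(1)[OF tendsto_diff[OF A(2) B(2)]]) (simp add: favours_def)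
  ultimately show ?thesis by eventually_elim (simp add: favours_def)
qed

section \<open>The bottom class\<close>

text \<open>In the applications \<open>t\<close> is the consumption of class B and \<open>t'\<close>
  that of class A. The intensities are crossed relative to the top: the trait that links A to HR
  also links B to LP, so LP lags behind B with intensity \<open>p\<close> and behind A with
  intensity \<open>q\<close>.\<close>

definition bottom :: "real \<Rightarrow> real \<Rightarrow> real \<Rightarrow> real \<Rightarrow> real \<Rightarrow> real" where
  "bottom p t q t' v = response (\<lambda>x. p * mcost (t - x) + q * mcost (t' - x)) v"

definition bottom_utility :: "real \<Rightarrow> real \<Rightarrow> real \<Rightarrow> real \<Rightarrow> real \<Rightarrow> real" where
  "bottom_utility p t q t' l =
     (let x = bottom p t q t' l in u x l - (p * cost (t - x) + q * cost (t' - x)))"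

lemma bottom_foc:
  assumes "0 \<le> p" "0 \<le> q" "v \<in> Y"
  shows "0 < bottom p t q t' v"
    "u_x (bottom p t q t' v) v + (p * mcost (t - bottom p t q t' v) + q * mcost (t' - bottom p t q t' v)) = 0"
proof -
  have "load (\<lambda>x. p * mcost (t - x) + q * mcost (t' - x))"
    by (intro load_add load_mcost assms)
  from response_pos[OF this assms(3)] response_props(2)[OF this assms(3)]
  show "0 < bottom p t q t' v"
    "u_x (bottom p t q t' v) v + (p * mcost (t - bottom p t q t' v) + q * mcost (t' - bottom p t q t' v)) = 0"
    unfolding bottom_def by simp_all
qed

text \<open>At the lower of the two middle consumptions, LP bears load only toward the other middle
  class. The class consuming there has the same intensity toward the still higher target
  \<open>t\<close>, and a higher income; its first-order condition therefore forces the marginal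
  payoff of LP to be negative.\<close>

lemma bottom_less:
  assumes c: "0 \<le> p" "0 \<le> q" and Y: "a \<in> Y" "b \<in> Y" "l \<in> Y" "l < a" "l < b"
    and t: "0 \<le> t" "u_x t a < 0" "u_x t b < 0"
  shows "bottom p (follow t q b) q (follow t p a) l < follow t q b"
    "bottom p (follow t q b) q (follow t p a) l < follow t p a"
proof -
  let ?A = "follow t p a" and ?B = "follow t q b"
  have pos: "0 < ?A" "0 < ?B" and less: "?A \<le> t" "?B \<le> t"
    using follow_pos follow_less assms by (auto intro!: less_imp_le)
  have "bottom p ?B q ?A l < min ?A ?B"
    unfolding bottom_def
  proof (rule response_less[OF load_add[OF load_mcost load_mcost]])
    show "u_x (min ?A ?B) l + (p * mcost (?B - min ?A ?B) + q * mcost (?A - min ?A ?B)) < 0"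
    proof (cases "?A \<le> ?B")
      case True
      have "p * mcost (?B - ?A) \<le> p * mcost (t - ?A)"
        using c less by (intro mult_left_mono mcost_mono) auto
      then have "u_x ?A l + p * mcost (?B - ?A) < u_x ?A a + p * mcost (t - ?A)"
        using u_x_strict_mono_v[of ?A l a] pos Y by simp
      then show ?thesis using True follow_foc[of p a t] c Y by (simp add: min_def)
    next
      case False
      have "q * mcost (?A - ?B) \<le> q * mcost (t - ?B)"
        using c less by (intro mult_left_mono mcost_mono) auto
      then have "u_x ?B l + q * mcost (?A - ?B) < u_x ?B b + q * mcost (t - ?B)"
        using u_x_strict_mono_v[of ?B l b] pos Y by simp
      then show ?thesis using False follow_foc[of q b t] c Y by (simp add: min_def)
    qed
  qed (use assms pos in auto)
  then show "bottom p ?B q ?A l < ?B" "bottom p ?B q ?A l < ?A" by simp_all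
qed

text \<open>The reaction of LP itself drops out by its first-order condition, leaving only the
  motion of the targets. The reaction must still be shown differentiable, and the strict gaps serve
  this purpose.\<close>

lemma bottom_utility_deriv:
  fixes t t' :: "real \<Rightarrow> real"
  assumes pq: "0 \<le> p" "0 \<le> q" and l: "l \<in> Y"
    and t: "(t has_real_derivative D) (at s)" and t': "(t' has_real_derivative D') (at s)"
    and less: "bottom p (t s) q (t' s) l < t s" "bottom p (t s) q (t' s) l < t' s"
  shows "((\<lambda>r. bottom_utility p (t r) q (t' r) l) has_real_derivative - (p * mcost (t s - bottom p (t s) q (t' s) l) * D +
      q * mcost (t' s - bottom p (t s) q (t' s) l) * D')) (at s)"
proof -
  define X where "X r = bottom p (t r) q (t' r) l" for r
  let ?g = "\<lambda>x r. u_x x l + (p * mcost (t r - x) + q * mcost (t' r - x))"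
  let ?gx = "\<lambda>x r. u_xx x l - (p * f' (t r - x) + q * f' (t' r - x))"
  have tt: "(t \<longlongrightarrow> t s) (at s)" "(t' \<longlongrightarrow> t' s) (at s)"
    using DERIV_isCont[OF t] DERIV_isCont[OF t'] by (simp_all add: isCont_def)
  have X: "(X \<longlongrightarrow> X s) (at s)"
    unfolding X_def bottom_def
    by (rule response_tendsto)
      (use pq l tt in \<open>auto intro!: always_eventually load_add load_mcost tendsto_intros mcost_tendsto\<close>)
  have pos: "0 < X r" and foc: "?g (X r) r = 0" for r
    unfolding X_def using bottom_foc[OF pq l, of "t r" "t' r"] by auto
  have lt: "X s < t s" "X s < t' s" using less by (simp_all add: X_def)
  define K where "K = - (p * f' (t s - X s) * D + q * f' (t' s - X s) * D') / ?gx (X s) s"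
  have dX: "(X has_real_derivative K) (at s)"
    unfolding K_def
  proof (rule implicit_derivative[where g = ?g and gx = ?gx])
    have "((\<lambda>r. mcost (t r - X s)) has_real_derivative f' (t s - X s) * (D - 0)) (at s)"
      "((\<lambda>r. mcost (t' r - X s)) has_real_derivative f' (t' s - X s) * (D' - 0)) (at s)"
      using lt by (intro DERIV_chain2[OF mcost_deriv] DERIV_diff DERIV_const t t'; simp)+
    from DERIV_add[OF DERIV_const[of "u_x (X s) l"] DERIV_add[OF DERIV_cmult[OF this(1), of p] DERIV_cmult[OF this(2), of q]]]
    show "((\<lambda>r. ?g (X s) r) has_real_derivative p * f' (t s - X s) * D + q * f' (t' s - X s) * D') (at s)"
      by (simp add: mult.assoc)
    have gap: "\<forall>\<^sub>F r in at s. 0 < k r - X r" "\<forall>\<^sub>F r in at s. 0 < k r - X s"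
      if "(k \<longlongrightarrow> k s) (at s)" "X s < k s" for k
      using order_tendstoD(1)[OF tendsto_diff[OF that(1) X], of 0]
        order_tendstoD(1)[OF tendsto_diff[OF that(1) tendsto_const], of 0 "X s"] that(2) by simp_all
    show "\<forall>\<^sub>F r in at s. \<forall>x\<in>closed_segment (X s) (X r).
        ((\<lambda>x. ?g x r) has_real_derivative ?gx x r) (at x)"
      using gap[OF tt(1) lt(1)] gap[OF tt(2) lt(2)]
    proof eventually_elim
      case (elim r)
      show ?case
      proof
        fix x assume "x \<in> closed_segment (X s) (X r)"
        then have x: "0 < x" "x < t r" "x < t' r"
          using pos[of s] pos[of r] elim
          by (auto simp: closed_segment_eq_real_ivl split: if_splits)
        have "((\<lambda>x. mcost (k - x)) has_real_derivative f' (k - x) * (0 - 1)) (at x)" if "x < k" for k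
          using that by (intro DERIV_chain2[OF mcost_deriv] DERIV_diff DERIV_const DERIV_ident) simp
        note d = this[OF x(2)] this[OF x(3)]
        from DERIV_add[OF has_u_xx_at[OF x(1) l] DERIV_add[OF DERIV_cmult[OF d(1), of p] DERIV_cmult[OF d(2), of q]]]
        show "((\<lambda>x. ?g x r) has_real_derivative ?gx x r) (at x)" by (simp add: algebra_simps)
      qed
    qed
    show "((\<lambda>r. ?gx (\<xi> r) r) \<longlongrightarrow> ?gx (X s) s) (at s)" if \<xi>: "(\<xi> \<longlongrightarrow> X s) (at s)" for \<xi>
    proof (intro tendsto_diff tendsto_add tendsto_mult tendsto_const f'_tendsto \<xi> tt)
      show "((\<lambda>r. u_xx (\<xi> r) l) \<longlongrightarrow> u_xx (X s) l) (at s)"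
        by (rule partial_tendsto) (use \<xi> pos l in auto)
    qed (use lt in simp_all)
    have "0 \<le> p * f' (t s - X s) + q * f' (t' s - X s)"
      using pq lt f'_nonneg by simp
    then show "?gx (X s) s \<noteq> 0" using u_xx_neg[of "X s" l] pos[of s] l by simp
  qed (use X foc in auto)
  have "((\<lambda>r. cost (t r - X r)) has_real_derivative mcost (t s - X s) * (D - K)) (at s)"
    "((\<lambda>r. cost (t' r - X r)) has_real_derivative mcost (t' s - X s) * (D' - K)) (at s)"
    by (intro DERIV_chain2[OF cost_deriv] DERIV_diff t t' dX)+
  from DERIV_diff[OF DERIV_chain2[OF has_u_x_at[OF pos l] dX] DERIV_add[OF DERIV_cmult[OF this(1), of p] DERIV_cmult[OF this(2), of q]]]
  have "((\<lambda>r. u (X r) l - (p * cost (t r - X r) + q * cost (t' r - X r))) has_real_derivative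
      u_x (X s) l * K - (p * (mcost (t s - X s) * (D - K)) + q * (mcost (t' s - X s) * (D' - K)))) (at s)" .
  \<comment> \<open>Collecting the terms with \<open>K\<close> exposes the first-order condition as
    their coefficient.\<close>
  moreover have "u_x (X s) l * K - (p * (mcost (t s - X s) * (D - K)) + q * (mcost (t' s - X s) * (D' - K))) =
      ?g (X s) s * K - (p * mcost (t s - X s) * D + q * mcost (t' s - X s) * D')"
    by (simp add: algebra_simps)
  ultimately show ?thesis using foc[of s] by (simp add: X_def bottom_utility_def Let_def)
qed

end

section \<open>Welfare weights under Pigou-Dalton\<close>

text \<open>Otherwise \<open>W\<close> would have a negative derivative along a transfer from
  \<open>i\<close> to \<open>j\<close>, and a small such transfer would lower it.\<close>

lemma pigou_dalton_gradient:
  fixes W :: "real ^ 'n::finite \<Rightarrow> real"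
  assumes "pigou_dalton W" and W: "(W has_derivative (\<lambda>h. g \<bullet> h)) (at U)" and less: "U $ j < U $ i"
  shows "g $ i \<le> g $ j"
proof (rule ccontr)
  assume "\<not> g $ i \<le> g $ j"
  define w :: "real ^ 'n" where "w = axis j 1 - axis i 1"
  have path: "((\<lambda>\<epsilon>. U + \<epsilon> *\<^sub>R w) has_derivative (\<lambda>\<epsilon>. \<epsilon> *\<^sub>R w)) (at 0)"
    by (auto intro!: derivative_eq_intros)
  have "((\<lambda>\<epsilon>. W (U + \<epsilon> *\<^sub>R w)) has_derivative (\<lambda>\<epsilon>. g \<bullet> (\<epsilon> *\<^sub>R w))) (at 0)"
    using has_derivative_compose[OF path, of W "\<lambda>h. g \<bullet> h"] W by simp
  then have deriv: "((\<lambda>\<epsilon>. W (U + \<epsilon> *\<^sub>R w)) has_real_derivative g \<bullet> w) (at 0)"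
    by (simp add: has_field_derivative_def mult_commute_abs)
  have "g \<bullet> w < 0"
    using \<open>\<not> g $ i \<le> g $ j\<close> by (simp add: w_def inner_diff_right inner_axis)
  from DERIV_neg_dec_right[OF deriv this]
  obtain d where d: "0 < d" "\<forall>h>0. h < d \<longrightarrow> W (U + h *\<^sub>R w) < W U" by auto
  \<comment> \<open>Small enough for the strict decrease, and at most half the utility gap so that
    the transfer does not reverse the ordering.\<close>
  define \<epsilon> where "\<epsilon> = min (d / 2) ((U $ i - U $ j) / 2)"
  have \<epsilon>: "0 < \<epsilon>" "\<epsilon> < d" "\<epsilon> \<le> (U $ i - U $ j) / 2"
    unfolding \<epsilon>_def using d less
    by (simp_all only: min_less_iff_conj min.cobounded2) auto
  have "U + \<epsilon> *\<^sub>R w = (\<chi> k. if k = i then U $ i - \<epsilon> else if k = j then U $ j + \<epsilon> else U $ k)"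
    using less by (auto simp: vec_eq_iff w_def axis_def)
  moreover have "U $ i - \<epsilon> \<ge> U $ j + \<epsilon>" using \<epsilon>(3) by (simp add: field_simps)
  ultimately have "W U \<le> W (U + \<epsilon> *\<^sub>R w)"
    using assms(1) less \<epsilon>(1) unfolding pigou_dalton_def by simp
  then show False using d \<epsilon> by force
qed

section \<open>Equilibrium payoffs with the middle classes in either order\<close>

text \<open>Allowing the two middle classes in either order makes \<open>\<rho> \<rightarrow> 1\<close> and \<open>\<rho> \<rightarrow> 0\<close> the
  same limit, \<open>q \<rightarrow> 0\<close> with \<open>p\<close> bounded away from \<open>0\<close>.\<close>

definition middle_classes ::
  "real \<Rightarrow> real \<Rightarrow> real \<Rightarrow> agent_class \<Rightarrow> agent_class \<Rightarrow> real \<Rightarrow> real \<Rightarrow> bool" where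
  "middle_classes d \<omega> \<rho> A B p q \<longleftrightarrow>
     A = (High, Poor) \<and> B = (Low, Rich) \<and> p = d * (\<rho> * (1 - \<omega>)) \<and> q = d * ((1 - \<rho>) * (1 - \<omega>)) \<or>
     A = (Low, Rich) \<and> B = (High, Poor) \<and> p = d * ((1 - \<rho>) * (1 - \<omega>)) \<and> q = d * (\<rho> * (1 - \<omega>))"

lemma UNIV_middle_classes:
  assumes "middle_classes d \<omega> \<rho> A B p q"
  shows "(UNIV :: agent_class set) = {(High, Rich), A, B, (Low, Poor)}"
    and "distinct [(High, Rich), A, B, (Low, Poor)]"
  using assms unfolding middle_classes_def by (auto simp: UNIV_agent_class)

lemma link_share_sums:
  fixes h :: "agent_class \<Rightarrow> real"
  assumes "middle_classes d \<omega> \<rho> A B p q"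
  shows "(\<Sum>k\<in>UNIV. d * link_share \<omega> \<rho> (High, Rich) k * h k) = d * \<omega> * h (High, Rich) + p * h A + q * h B"
    and "(\<Sum>k\<in>UNIV. d * link_share \<omega> \<rho> A k * h k) = d * \<omega> * h A + p * h (High, Rich) + q * h (Low, Poor)"
    and "(\<Sum>k\<in>UNIV. d * link_share \<omega> \<rho> B k * h k) = d * \<omega> * h B + q * h (High, Rich) + p * h (Low, Poor)"
    and "(\<Sum>k\<in>UNIV. d * link_share \<omega> \<rho> (Low, Poor) k * h k) = d * \<omega> * h (Low, Poor) + p * h B + q * h A"
  using assms unfolding middle_classes_def
  by (elim disjE conjE; simp add: UNIV_agent_class link_share_def)+

context status_game
begin

lemma u_x_x_a_neg: "v \<in> Y \<Longrightarrow> w \<in> Y \<Longrightarrow> v < w \<Longrightarrow> u_x (x_a u w) v < 0"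
  using u_x_strict_mono_v[of "x_a u w" v w] x_a_foc[of w] x_a_interior[of w] by simp

lemma class_payoffs:
  fixes cls :: "'n::finite \<Rightarrow> agent_class" and e :: "agent_class \<Rightarrow> real"
  assumes G: "network cls d \<omega> \<rho> G" and AB: "middle_classes d \<omega> \<rho> A B p q"
    and e: "\<And>k. e k \<in> Y" "e A < e (High, Rich)" "e B < e (High, Rich)"
      "e (Low, Poor) < e A" "e (Low, Poor) < e B"
  defines "t \<equiv> x_a u (e (High, Rich))"
  shows "equilibrium_payoffs u F G (\<lambda>i. e (cls i)) = (\<chi> i.
    if cls i = (High, Rich) then V u (e (High, Rich))
    else if cls i = A then follow_utility t p (e A)
    else if cls i = B then follow_utility t q (e B)
    else bottom_utility p (follow t q (e B)) q (follow t p (e A)) (e (Low, Poor)))"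
proof -
  let ?A = "follow t p (e A)" and ?B = "follow t q (e B)"
  let ?L = "bottom p ?B q ?A (e (Low, Poor))"
  \<comment> \<open>The triangular solution, verified rather than derived: with \<open>?L\<close>
    below \<open>?A\<close> and \<open>?B\<close>, and these below \<open>t\<close>, every term
    toward an equal or lower class vanishes.\<close>
  let ?X = "\<lambda>k. if k = (High, Rich) then t else if k = A then ?A else if k = B then ?B else ?L"
  have d: "0 < d" "0 < \<omega>" "\<omega> < 1" "0 < \<rho>" "\<rho> < 1" using G by (auto simp: network_def)
  then have pq: "0 \<le> p" "0 \<le> q" using AB by (auto simp: middle_classes_def)
  have t: "0 < t" "u_x t (e A) < 0" "u_x t (e B) < 0" "u_x t (e (High, Rich)) = 0"
    using e x_a_interior x_a_foc by (auto simp: t_def u_x_x_a_neg)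
  have less: "?A < t" "?B < t" "?L < ?A" "?L < ?B"
    using bottom_less[of p q "e A" "e B" "e (Low, Poor)" t] follow_less[of p "e A" t]
      follow_less[of q "e B" t] pq e t by auto
  have pos: "0 < ?A" "0 < ?B" "0 < ?L"
    using pq e follow_pos bottom_foc(1) by auto
  note foc = follow_foc[OF pq(1) e(1)[of A], of t] follow_foc[OF pq(2) e(1)[of B], of t]
    bottom_foc(2)[OF pq e(1)[of "(Low, Poor)"], of ?B ?A]
  note dist = UNIV_middle_classes(2)[OF AB] and sums = link_share_sums[OF AB]
  have X: "0 \<le> ?X k \<and> u_x (?X k) (e k) +
      (\<Sum>k'\<in>UNIV. d * link_share \<omega> \<rho> k k' * mcost (?X k' - ?X k)) = 0" for k
  proof -
    have "k \<in> {(High, Rich), A, B, (Low, Poor)}" using UNIV_middle_classes(1)[OF AB] by blast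
    then show ?thesis using dist less pos foc t by (auto simp: sums add.assoc)
  qed
  have "u (?X k) (e k) - (\<Sum>k'\<in>UNIV. d * link_share \<omega> \<rho> k k' * cost (?X k' - ?X k)) =
     (if k = (High, Rich) then V u (e (High, Rich))
      else if k = A then follow_utility t p (e A)
      else if k = B then follow_utility t q (e B)
      else bottom_utility p ?B q ?A (e (Low, Poor)))" for k
  proof -
    have "k \<in> {(High, Rich), A, B, (Low, Poor)}" using UNIV_middle_classes(1)[OF AB] by blast
    then show ?thesis using dist less pos
      by (auto simp: sums follow_utility_def V_def t_def bottom_utility_def Let_def)
  qed
  then show ?thesis
    by (simp only: class_equilibrium[where X = ?X and y = e, OF G e(1) X])
qed

end

lemma has_derivative_class_vector:
  fixes cls :: "'n::finite \<Rightarrow> 'k" and P :: "'k \<Rightarrow> real \<Rightarrow> real"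
  assumes W: "(W has_derivative (\<lambda>h. g \<bullet> h)) (at (\<chi> i. P (cls i) s))"
    and P: "\<And>k. (P k has_real_derivative P' k) (at s)"
  shows "((\<lambda>r. W (\<chi> i. P (cls i) r)) has_real_derivative (\<Sum>i\<in>UNIV. g $ i * P' (cls i))) (at s)"
proof -
  have "((\<lambda>r. \<chi> i. P (cls i) r) has_derivative (\<lambda>h. \<chi> i. h * P' (cls i))) (at s)"
  proof (rule has_derivative_componentwise_within[THEN iffD2], rule ballI)
    fix b :: "real ^ 'n" assume "b \<in> Basis"
    then obtain i where b: "b = axis i 1" by (auto simp: Basis_vec_def)
    have "(P (cls i) has_derivative (\<lambda>h. h * P' (cls i))) (at s)"
      using P[of "cls i"] by (simp add: has_field_derivative_def mult_commute_abs)
    then show "((\<lambda>r. (\<chi> i. P (cls i) r) \<bullet> b) has_derivative (\<lambda>h. (\<chi> i. h * P' (cls i)) \<bullet> b)) (at s)"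
      by (simp add: b inner_axis)
  qed
  from has_derivative_compose[OF this, of W "\<lambda>h. g \<bullet> h"] W
  have "((\<lambda>r. W (\<chi> i. P (cls i) r)) has_derivative (\<lambda>h. g \<bullet> (\<chi> i. h * P' (cls i)))) (at s)"
    by simp
  moreover have "(\<lambda>h. g \<bullet> (\<chi> i. h * P' (cls i))) = (*) (\<Sum>i\<in>UNIV. g $ i * P' (cls i))"
    by (rule ext) (simp add: inner_vec_def sum_distrib_left ac_simps)
  ultimately show ?thesis by (simp add: has_field_derivative_def)
qed

lemma deriv_zero_imp_eq:
  fixes h :: "real \<Rightarrow> real"
  assumes "\<And>s. s \<in> {0<..<1} \<Longrightarrow> (h has_real_derivative 0) (at s)" "r \<in> {0<..<1}" "s \<in> {0<..<1}"
  shows "h r = h s"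
proof -
  have "\<exists>c. \<forall>x\<in>{0<..<1}. h x = c"
    by (rule has_field_derivative_zero_constant)
      (auto intro: has_field_derivative_at_within[OF assms(1)])
  then show ?thesis using assms(2,3) by auto
qed

text \<open>Here \<open>k\<close> is the class size. The middle classes contribute at least
  \<open>k * m * (uA - uB)\<close>, which exceeds the largest weighted loss
  \<open>k * M * loss\<close> of the bottom class.\<close>

lemma weighted_gains_positive:
  fixes g_A g_B g_L k m M uA uB gain loss :: real
  assumes "g_B \<le> g_A" "k * m \<le> g_B" "g_L \<le> k * M" "0 < k" "0 < m" "0 \<le> g_L"
    and "0 \<le> uB" "uB < uA" "0 \<le> gain" "0 \<le> loss" "M * loss < m * (uA - uB)"
  shows "0 < g_A * uA - g_B * uB + g_L * (gain - loss)"
proof -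
  have "g_B * uA \<le> g_A * uA" using assms by (intro mult_right_mono) auto
  moreover have "k * m * (uA - uB) \<le> g_B * (uA - uB)" using assms by (intro mult_right_mono) auto
  moreover have "g_L * loss \<le> k * M * loss" using assms by (intro mult_right_mono) auto
  moreover have "0 \<le> g_L * gain" using assms by simp
  moreover have "k * (M * loss) < k * (m * (uA - uB))" using assms by (intro mult_strict_left_mono) auto
  ultimately show ?thesis by (simp add: algebra_simps)
qed

section \<open>The crossing of the middle incomes\<close>

context earning_potential
begin

lemma y_HR_eq: "r \<in> {0<..<1} \<Longrightarrow> s \<in> {0<..<1} \<Longrightarrow> y High Rich r = y High Rich s"
  and y_LP_eq: "r \<in> {0<..<1} \<Longrightarrow> s \<in> {0<..<1} \<Longrightarrow> y Low Poor r = y Low Poor s"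
  by (rule deriv_zero_imp_eq[OF y_deriv_HR]; assumption)
    (rule deriv_zero_imp_eq[OF y_deriv_LP]; assumption)

lemma y_gap_strict_mono:
  assumes "r \<in> {0<..<1}" "s \<in> {0<..<1}" "r < s"
  shows "y High Poor r - y Low Rich r < y High Poor s - y Low Rich s"
proof (rule DERIV_pos_imp_increasing[OF assms(3)])
  fix x assume "r \<le> x" "x \<le> s"
  then obtain v where "v > 0" "(y High Poor has_real_derivative v) (at x)"
      "(y Low Rich has_real_derivative - v) (at x)"
    using y_deriv_HP_LR[of x] assms by auto
  then show "\<exists>z. ((\<lambda>s. y High Poor s - y Low Rich s) has_real_derivative z) (at x) \<and> 0 < z"
    by (intro exI[of _ "v - - v"] conjI DERIV_diff) auto
qed

lemma y_end_tendsto: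
  "((\<lambda>s. y a b s) \<longlongrightarrow> y a b 0) (at_right 0)" "((\<lambda>s. y a b s) \<longlongrightarrow> y a b 1) (at_left 1)"
  using y_continuous[of a b]
  by (simp_all add: continuous_on_Icc_at_rightD continuous_on_Icc_at_leftD)

text \<open>At mobility 0 only background counts, so HP earns as LP and LR as HR; at mobility 1 only
  ability counts and the roles are exchanged. Hence the income gap changes sign.\<close>

lemma crossing_exists: "\<exists>s. s \<in> {0<..<1} \<and> y High Poor s = y Low Rich s"
proof -
  have half: "(1/2 :: real) \<in> {0<..<1}" by simp
  have near0: "\<forall>\<^sub>F s in at_right (0::real). s \<in> {0<..<1}"
    by (rule eventually_at_right_real) simp
  have near1: "\<forall>\<^sub>F s in at_left (1::real). s \<in> {0<..<1}"
    by (rule eventually_at_left_real) simp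
  \<comment> \<open>Constancy of the extreme incomes is given on the open interval; continuity
    extends it to the endpoints.\<close>
  have const: "y High Rich 0 = y High Rich (1/2)" "y High Rich 1 = y High Rich (1/2)"
    "y Low Poor 0 = y Low Poor (1/2)" "y Low Poor 1 = y Low Poor (1/2)"
    using tendsto_unique[OF trivial_limit_at_right_real y_end_tendsto(1)[of High Rich]
        tendsto_eventually[OF eventually_mono[OF near0 y_HR_eq[OF _ half]]]]
      tendsto_unique[OF trivial_limit_at_left_real y_end_tendsto(2)[of High Rich]
        tendsto_eventually[OF eventually_mono[OF near1 y_HR_eq[OF _ half]]]]
      tendsto_unique[OF trivial_limit_at_right_real y_end_tendsto(1)[of Low Poor]
        tendsto_eventually[OF eventually_mono[OF near0 y_LP_eq[OF _ half]]]]
      tendsto_unique[OF trivial_limit_at_left_real y_end_tendsto(2)[of Low Poor]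
        tendsto_eventually[OF eventually_mono[OF near1 y_LP_eq[OF _ half]]]]
    by simp_all
  have 0: "y High b 0 = y Low b 0" for b
    using tendsto_unique[OF trivial_limit_at_right_real y_ability_lim[of b]
        tendsto_diff[OF y_end_tendsto(1)[of High b] y_end_tendsto(1)[of Low b]]] by simp
  have 1: "y a Rich 1 = y a Poor 1" for a
    using tendsto_unique[OF trivial_limit_at_left_real y_background_lim[of a]
        tendsto_diff[OF y_end_tendsto(2)[of a Rich] y_end_tendsto(2)[of a Poor]]] by simp
  have "y Low Poor (1/2) < y High Rich (1/2)"
    using y_ability[OF half, of Poor] y_background[OF half, of High] by simp
  then have ends: "y High Poor 0 - y Low Rich 0 < 0" "0 < y High Poor 1 - y Low Rich 1"
    using const 0[of Rich] 0[of Poor] 1[of High] 1[of Low] by simp_all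
  have "continuous_on {0..1} (\<lambda>s. y High Poor s - y Low Rich s)"
    by (intro continuous_intros y_continuous)
  then obtain s where s: "0 \<le> s" "s \<le> 1" "y High Poor s - y Low Rich s = 0"
    using IVT'[of "\<lambda>s. y High Poor s - y Low Rich s" 0 0 1] ends by auto
  then have "s \<noteq> 0" "s \<noteq> 1" using ends by auto
  then show ?thesis using s by (intro exI[of _ s]) auto
qed

lemma s_y_crossing: "s_y y \<in> {0<..<1}" "y High Poor (s_y y) = y Low Rich (s_y y)"
proof -
  have "\<exists>!s. s \<in> {0<..<1} \<and> y High Poor s = y Low Rich s"
  proof (rule ex_ex1I[OF crossing_exists])
    fix r s assume "r \<in> {0<..<1} \<and> y High Poor r = y Low Rich r" "s \<in> {0<..<1} \<and> y High Poor s = y Low Rich s"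
    then show "r = s"
      using y_gap_strict_mono[of r s] y_gap_strict_mono[of s r] by (cases r s rule: linorder_cases) auto
  qed
  from theI'[OF this] show "s_y y \<in> {0<..<1}" "y High Poor (s_y y) = y Low Rich (s_y y)"
    unfolding s_y_def by blast+
qed

lemma y_gap_sign:
  assumes "s \<in> {0<..<1}"
  shows "s \<le> s_y y \<Longrightarrow> y High Poor s \<le> y Low Rich s" "s_y y \<le> s \<Longrightarrow> y Low Rich s \<le> y High Poor s"
  using y_gap_strict_mono[OF assms s_y_crossing(1)] y_gap_strict_mono[OF s_y_crossing(1) assms]
    s_y_crossing(2) by (cases "s = s_y y"; simp)+

lemma y_order:
  assumes "s \<in> {0<..<1}"
  shows "y High Poor s < y High Rich s" "y Low Rich s < y High Rich s"
    "y Low Poor s < y High Poor s" "y Low Poor s < y Low Rich s"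
  using y_ability[OF assms] y_background[OF assms] by auto

end

section \<open>The derivative of equilibrium welfare\<close>

locale society = status_game + earning_potential +
  fixes d \<omega> :: real and cls :: "'n::finite \<Rightarrow> agent_class" and W :: "real ^ 'n \<Rightarrow> real"
    and DW :: "real ^ 'n \<Rightarrow> real ^ 'n" and m M :: real
  assumes y_in_Y: "s \<in> {0..1} \<Longrightarrow> y a b s \<in> Y"
    and d_pos: "0 < d" and \<omega>: "\<omega> \<in> {0<..<1}"
    and pop: "population cls"
    and W_deriv: "(W has_derivative (\<lambda>h. DW U \<bullet> h)) (at U)"
    and DW_bounds: "0 < m" "m \<le> DW U $ i" "DW U $ i \<le> M"
    and W_pigou_dalton: "pigou_dalton W"
begin

text \<open>The value 1/2 is an arbitrary interior mobility, since the income of HR is constant on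
  the open interval.\<close>

definition t_top :: real where
  "t_top = x_a u (y High Rich (1 / 2))"

lemma y_top: "s \<in> {0<..<1} \<Longrightarrow> x_a u (y High Rich s) = t_top"
  unfolding t_top_def by (subst y_HR_eq[of s "1/2"]) auto

lemma t_top_pos: "0 < t_top"
  unfolding t_top_def by (intro x_a_interior y_in_Y) simp

abbreviation earn :: "agent_class \<Rightarrow> real \<Rightarrow> real" where
  "earn k \<equiv> y (fst k) (snd k)"

lemma lagging:
  assumes "s \<in> {0<..<1}" "k \<in> {(High, Poor), (Low, Rich)}"
  shows "u_x t_top (earn k s) < 0"
  using u_x_x_a_neg[of "earn k s" "y High Rich s"] assms y_order[OF assms(1)]
  by (auto simp: y_top y_in_Y)

text \<open>Equal class sizes give a bijection, which lifts the comparison of individual gradient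
  entries to class weights.\<close>

lemma class_sum_le:
  assumes "\<And>i j. cls i = A \<Longrightarrow> cls j = B \<Longrightarrow> g j \<le> g i"
  shows "(\<Sum>j | cls j = B. g j) \<le> (\<Sum>i | cls i = A. g i :: real)"
proof -
  interpret population cls by (rule pop)
  have "card {i. cls i = A} = card {i. cls i = B}" by (simp add: class_size)
  then obtain f where f: "bij_betw f {i. cls i = A} {i. cls i = B}"
    using finite_same_card_bij[of "{i. cls i = A}" "{i. cls i = B}"] by auto
  have "(\<Sum>j | cls j = B. g j) = (\<Sum>i | cls i = A. g (f i))"
    using sum.reindex_bij_betw[OF f, of g] by simp
  also have "\<dots> \<le> (\<Sum>i | cls i = A. g i)"
    using f by (intro sum_mono assms) (auto simp: bij_betw_def)
  finally show ?thesis .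
qed

text \<open>The factor \<alpha> carries the sign: it is positive when A is HP and negative when A is
  LR, while \<open>E\<close> is positive in both cases. The hypothesis \<open>small\<close> makes
  the harm to LP negligible.\<close>

lemma welfare_deriv:
  assumes s: "s \<in> {0<..<1}" and G: "network cls d \<omega> \<rho> G" and AB: "middle_classes d \<omega> \<rho> A B p q"
    and fav: "favours t_top p q (earn A s) (earn B s)"
    and dA: "(earn A has_real_derivative \<alpha>) (at s)" and dB: "(earn B has_real_derivative - \<alpha>) (at s)"
    and small: "M * (q * mcost t_top * (u_xy (follow t_top p (earn A s)) (earn A s) /
        (- u_xx (follow t_top p (earn A s)) (earn A s)))) <
      m * (u_y (follow t_top p (earn A s)) (earn A s) - u_y (follow t_top q (earn B s)) (earn B s))"
  shows "\<exists>E>0. (equilibrium_welfare cls y u F W G has_real_derivative \<alpha> * E) (at s)"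
proof -
  interpret population cls by (rule pop)
  let ?HR = "(High, Rich) :: agent_class" and ?LP = "(Low, Poor) :: agent_class"
  define l where "l = y Low Poor s"
  define XA XB where "XA r = follow t_top p (earn A r)" and "XB r = follow t_top q (earn B r)" for r
  \<comment> \<open>The incomes of HR and LP are frozen at \<open>s\<close>, so that only middle
    incomes vary with \<open>r\<close>; this agrees with the payoffs for all \<open>r\<close> in the
    open interval.\<close>
  define P where "P k r =
    (if k = ?HR then V u (y High Rich s)
     else if k = A then follow_utility t_top p (earn A r)
     else if k = B then follow_utility t_top q (earn B r)
     else bottom_utility p (XB r) q (XA r) l)" for k r
  have mid: "A \<in> {(High, Poor), (Low, Rich)}" "B \<in> {(High, Poor), (Low, Rich)}"
    using AB by (auto simp: middle_classes_def)
  note univ = UNIV_middle_classes(1)[OF AB] and distinct = UNIV_middle_classes(2)[OF AB]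
  have dist: "?HR \<noteq> A" "?HR \<noteq> B" "A \<noteq> B" "A \<noteq> ?LP" "B \<noteq> ?LP" "?HR \<noteq> ?LP"
    using distinct by auto
  have "0 < \<rho>" "\<rho> < 1" using G by (auto simp: network_def)
  then have pq: "0 \<le> p" "0 \<le> q" using AB d_pos \<omega> by (auto simp: middle_classes_def)
  have Y: "earn k r \<in> Y" if "r \<in> {0<..<1}" for k r using y_in_Y that by simp
  have lY: "l \<in> Y" using Y[OF s, of ?LP] by (simp add: l_def)
  have payoffs: "equilibrium_payoffs u F G (\<lambda>i. earn (cls i) r) = (\<chi> i. P (cls i) r)"
    if r: "r \<in> {0<..<1}" for r
  proof -
    have "earn A r < earn ?HR r" "earn B r < earn ?HR r" "earn ?LP r < earn A r" "earn ?LP r < earn B r"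
      using mid y_order[OF r] by auto
    from class_payoffs[OF G AB Y[OF r] this] show ?thesis
      using y_HR_eq[OF r s] y_LP_eq[OF r s] y_top[OF s] by (simp add: P_def XA_def XB_def l_def cong: if_cong)
  qed
  define U where "U = (\<chi> i. P (cls i) s)"
  define g where "g K = (\<Sum>i | cls i = K. DW U $ i)" for K
  note lagA = pq(1) Y[OF s, of A] less_imp_le[OF t_top_pos] lagging[OF s mid(1)]
  note lagB = pq(2) Y[OF s, of B] less_imp_le[OF t_top_pos] lagging[OF s mid(2)]
  define sA sB where "sA = follow_slope t_top p (earn A s)" and "sB = follow_slope t_top q (earn B s)"
  define uA uB where "uA = u_y (XA s) (earn A s)" and "uB = u_y (XB s) (earn B s)"
  define XL where "XL = bottom p (XB s) q (XA s) l"
  have XL: "0 < XL" "XL < XB s" "XL < XA s"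
    using bottom_foc(1)[OF pq] bottom_less[OF pq lagA(2) lagB(2) _ _ _ lagA(3,4) lagB(4)]
      Y[OF s, of ?LP] mid y_order[OF s]
    unfolding XL_def XA_def XB_def l_def by auto
  have XA: "XA s < t_top" using follow_less[OF lagA] by (simp add: XA_def)
  \<comment> \<open>Effects on LP per unit of \<alpha>: as income shifts from B to A, its target B
    recedes (\<open>gain\<close>) and its target A advances (\<open>loss\<close>).\<close>
  define gain loss where "gain = p * mcost (XB s - XL) * sB" and "loss = q * mcost (XA s - XL) * sA"
  have dXA: "(XA has_real_derivative sA * \<alpha>) (at s)"
    unfolding XA_def[abs_def] sA_def by (rule DERIV_chain2[OF follow_deriv[OF lagA] dA])
  have dXB: "(XB has_real_derivative sB * - \<alpha>) (at s)"
    unfolding XB_def[abs_def] sB_def by (rule DERIV_chain2[OF follow_deriv[OF lagB] dB])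
  have dL: "((\<lambda>r. bottom_utility p (XB r) q (XA r) l) has_real_derivative \<alpha> * (gain - loss)) (at s)"
    using bottom_utility_deriv[OF pq lY dXB dXA, folded XL_def, OF XL(2,3)]
    by (simp add: gain_def loss_def algebra_simps)
  define P' where "P' k = (if k = ?HR then 0 else if k = A then uA * \<alpha>
     else if k = B then uB * - \<alpha> else \<alpha> * (gain - loss))" for k
  have "(P k has_real_derivative P' k) (at s)" for k
    unfolding P_def[abs_def] P'_def uA_def uB_def XA_def XB_def
    using DERIV_chain2[OF follow_utility_deriv[OF lagA] dA] DERIV_chain2[OF follow_utility_deriv[OF lagB] dB]
      dL[unfolded XA_def XB_def] by simp
  moreover have "(W has_derivative (\<lambda>h. DW U \<bullet> h)) (at (\<chi> i. P (cls i) s))"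
    unfolding U_def[symmetric] by (rule W_deriv)
  ultimately
  have "((\<lambda>r. W (\<chi> i. P (cls i) r)) has_real_derivative (\<Sum>i\<in>UNIV. DW U $ i * P' (cls i))) (at s)"
    by (intro has_derivative_class_vector)
  moreover have "(\<Sum>i\<in>UNIV. DW U $ i * P' (cls i)) = \<alpha> * (g A * uA - g B * uB + g ?LP * (gain - loss))"
  proof -
    have "(\<Sum>i\<in>UNIV. DW U $ i * P' (cls i)) = (\<Sum>K\<in>UNIV. \<Sum>i | cls i = K. DW U $ i * P' (cls i))"
      by (rule sum_by_class)
    also have "\<dots> = (\<Sum>K\<in>UNIV. g K * P' K)"
      unfolding g_def sum_distrib_right by (intro sum.cong refl) simp
    also have "\<dots> = \<alpha> * (g A * uA - g B * uB + g ?LP * (gain - loss))"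
      unfolding univ by (simp add: P'_def dist dist[symmetric] algebra_simps)
    finally show ?thesis .
  qed
  ultimately have "((\<lambda>r. W (\<chi> i. P (cls i) r)) has_real_derivative
      \<alpha> * (g A * uA - g B * uB + g ?LP * (gain - loss))) (at s)" by simp
  then have "(equilibrium_welfare cls y u F W G has_real_derivative
      \<alpha> * (g A * uA - g B * uB + g ?LP * (gain - loss))) (at s)"
    by (rule has_field_derivative_transform_within_open[of _ _ _ "{0<..<1}"])
      (use s payoffs in \<open>auto simp: equilibrium_welfare_def\<close>)
  moreover have "0 < g A * uA - g B * uB + g ?LP * (gain - loss)"
  proof (rule weighted_gains_positive)
    let ?k = "real (CARD('n) div 4)"
    have "P A s < P B s" using fav dist by (auto simp: P_def favours_def)
    then show "g B \<le> g A"
      unfolding g_def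
      by (intro class_sum_le pigou_dalton_gradient[OF W_pigou_dalton W_deriv]) (simp add: U_def)
    show "?k * m \<le> g B" "g ?LP \<le> ?k * M"
      using sum_bounded_below[of "{i. cls i = B}" m "\<lambda>i. DW U $ i"]
        sum_bounded_above[of "{i. cls i = ?LP}" "\<lambda>i. DW U $ i" M] DW_bounds
      by (auto simp: g_def class_size)
    show "0 \<le> g ?LP" unfolding g_def using DW_bounds by (intro sum_nonneg) (meson less_imp_le order_trans)
    show "0 < ?k" using dvd_imp_le[OF four_dvd zero_less_card_finite] by (simp add: div_greater_zero_iff)
    show "0 \<le> uB" using u_y_pos[of "XB s" "earn B s"] follow_pos[OF lagB(1,2)] lagB(2)
      by (simp add: uB_def XB_def less_imp_le)
    show "uB < uA" using fav by (simp add: favours_def uA_def uB_def XA_def XB_def)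
    show "0 \<le> gain" "0 \<le> loss"
      using pq mcost_nonneg follow_slope_bounds(1)[OF lagA] follow_slope_bounds(1)[OF lagB]
      by (simp_all add: gain_def loss_def sA_def sB_def)
    have "0 < M" using DW_bounds(1) DW_bounds(2)[of U undefined] DW_bounds(3)[of U undefined] by linarith
    \<comment> \<open>The gap to A is at most \<open>t_top\<close>, so the bound no longer depends
      on LP's consumption and has an evident limit as \<open>q\<close> tends to 0.\<close>
    have "loss \<le> q * mcost t_top * (u_xy (XA s) (earn A s) / (- u_xx (XA s) (earn A s)))"
      unfolding loss_def
    proof (intro mult_mono mult_left_mono mcost_mono)
      show "sA \<le> u_xy (XA s) (earn A s) / (- u_xx (XA s) (earn A s))" "0 \<le> sA"
        using follow_slope_bounds[OF lagA] by (simp_all add: sA_def XA_def)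
    qed (use pq XA XL mcost_nonneg in auto)
    then have "M * loss \<le> M * (q * mcost t_top * (u_xy (XA s) (earn A s) / (- u_xx (XA s) (earn A s))))"
      using \<open>0 < M\<close> by (intro mult_left_mono) auto
    then show "M * loss < m * (uA - uB)"
      using small by (simp add: uA_def uB_def XA_def XB_def)
  qed (rule DW_bounds(1))
  ultimately show ?thesis by blast
qed

text \<open>As \<open>q\<close> tends to 0 the bound on the loss vanishes, while the gap in marginal
  utilities tends to a positive limit. Neither quantity involves \<open>G\<close> or the gradient of
  \<open>W\<close>, so one neighbourhood serves all networks.\<close>

lemma welfare_deriv_eventually:
  assumes s: "s \<in> {0<..<1}" and AB: "\<And>\<rho>. middle_classes d \<omega> \<rho> A B (p \<rho>) (q \<rho>)"
    and p: "(p \<longlongrightarrow> c) \<F>" "0 \<le> c" and q: "(q \<longlongrightarrow> 0) \<F>" and \<rho>: "\<forall>\<^sub>F \<rho> in \<F>. \<rho> \<in> {0<..<1}"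
    and fav: "favours t_top c 0 (earn A s) (earn B s)"
    and dA: "(earn A has_real_derivative \<alpha>) (at s)" and dB: "(earn B has_real_derivative - \<alpha>) (at s)"
  shows "\<forall>\<^sub>F \<rho> in \<F>. \<forall>G. network cls d \<omega> \<rho> G \<longrightarrow>
    (\<exists>E>0. (equilibrium_welfare cls y u F W G has_real_derivative \<alpha> * E) (at s))"
proof -
  have Y: "earn k s \<in> Y" for k using s y_in_Y by simp
  have "\<forall>\<^sub>F \<rho> in \<F>. 0 \<le> p \<rho> \<and> 0 \<le> q \<rho>"
    using \<rho>
  proof eventually_elim
    case (elim \<rho>)
    then show ?case using AB[of \<rho>] d_pos \<omega> by (auto simp: middle_classes_def)
  qed
  then have pq: "\<forall>\<^sub>F \<rho> in \<F>. 0 \<le> p \<rho>" "\<forall>\<^sub>F \<rho> in \<F>. 0 \<le> q \<rho>" by (auto elim: eventually_mono)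
  note p' = p(1) pq(1) p(2) and q' = q pq(2) order_refl
  have 1: "\<forall>\<^sub>F \<rho> in \<F>. favours t_top (p \<rho>) (q \<rho>) (earn A s) (earn B s)"
    by (rule favours_eventually[OF fav p' q' tendsto_const Y tendsto_const Y])
  let ?XA = "\<lambda>c. follow t_top c (earn A s)"
  define loss where "loss p q = M * (q * mcost t_top * (u_xy (?XA p) (earn A s) / (- u_xx (?XA p) (earn A s))))"
    for p q
  define gap where "gap p q = m * (u_y (?XA p) (earn A s) - u_y (follow t_top q (earn B s)) (earn B s))" for p q
  have XA: "((\<lambda>\<rho>. ?XA (p \<rho>)) \<longlongrightarrow> ?XA c) \<F>"
    by (rule follow_tendsto[OF p' tendsto_const Y])
  have pos: "0 < ?XA c" by (rule follow_pos[OF p(2) Y])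
  have xy: "((\<lambda>\<rho>. u_xy (?XA (p \<rho>)) (earn A s)) \<longlongrightarrow> u_xy (?XA c) (earn A s)) \<F>"
    by (rule partial_tendsto) (use XA pos Y in auto)
  have xx: "((\<lambda>\<rho>. u_xx (?XA (p \<rho>)) (earn A s)) \<longlongrightarrow> u_xx (?XA c) (earn A s)) \<F>"
    by (rule partial_tendsto) (use XA pos Y in auto)
  have "((\<lambda>\<rho>. loss (p \<rho>) (q \<rho>)) \<longlongrightarrow> loss c 0) \<F>"
    unfolding loss_def using u_xx_neg[of "?XA c" "earn A s"] pos Y
    by (intro tendsto_intros xy xx q) auto
  moreover have "((\<lambda>\<rho>. gap (p \<rho>) (q \<rho>)) \<longlongrightarrow> gap c 0) \<F>"
    unfolding gap_def
    by (intro tendsto_intros follow_utility_tendsto(2)[OF p' tendsto_const Y]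
        follow_utility_tendsto(2)[OF q' tendsto_const Y])
  ultimately have "((\<lambda>\<rho>. gap (p \<rho>) (q \<rho>) - loss (p \<rho>) (q \<rho>)) \<longlongrightarrow> gap c 0 - loss c 0) \<F>"
    by (intro tendsto_diff)
  moreover have "0 < gap c 0 - loss c 0"
    using fav DW_bounds(1) by (simp add: gap_def loss_def favours_def)
  ultimately have "\<forall>\<^sub>F \<rho> in \<F>. 0 < gap (p \<rho>) (q \<rho>) - loss (p \<rho>) (q \<rho>)"
    by (rule order_tendstoD(1))
  then show ?thesis
    using 1
  proof eventually_elim
    case (elim \<rho>)
    then show ?case
      using welfare_deriv[OF s _ AB elim(2) dA dB] by (auto simp: gap_def loss_def)
  qed
qed

text \<open>At \<open>s_y\<close> the incomes coincide and overconsumption alone makes the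
  inequalities strict; continuity of incomes spreads them to a neighbourhood.\<close>

lemma favours_near_crossing:
  assumes c: "0 < c" and AB: "A \<in> {(High, Poor), (Low, Rich)}" "B \<in> {(High, Poor), (Low, Rich)}"
    and eq: "earn A (s_y y) = earn B (s_y y)"
  shows "\<exists>\<epsilon>>0. \<forall>s\<in>{0<..<1}. dist s (s_y y) < \<epsilon> \<longrightarrow> favours t_top c 0 (earn A s) (earn B s)"
proof -
  note sy = s_y_crossing(1)
  have Y: "earn k (s_y y) \<in> Y" for k using sy y_in_Y by simp
  have fav: "favours t_top c 0 (earn A (s_y y)) (earn B (s_y y))"
    using c Y eq t_top_pos lagging[OF sy AB(1)] by (intro favours_poorer) auto
  have cont: "(earn k \<longlongrightarrow> earn k (s_y y)) (at (s_y y))" for k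
    using continuous_on_interior[OF y_continuous[of "fst k" "snd k"], of "s_y y"] sy by (simp add: isCont_def)
  have "\<forall>\<^sub>F s in at (s_y y). favours t_top c 0 (earn A s) (earn B s)"
    by (rule favours_eventually[OF fav tendsto_const _ _ tendsto_const _ _ cont Y cont Y]) (use c in auto)
  then obtain \<epsilon> where "0 < \<epsilon>" "\<forall>s. s \<noteq> s_y y \<and> dist s (s_y y) < \<epsilon> \<longrightarrow> favours t_top c 0 (earn A s) (earn B s)"
    unfolding eventually_at by auto
  then show ?thesis using fav by (metis (no_types))
qed

end

section \<open>The two limits of integration\<close>

theorem proposition4:
  fixes cls :: "'n::finite \<Rightarrow> agent_class"
    and y :: "ability \<Rightarrow> background \<Rightarrow> real \<Rightarrow> real"
    and Y :: "real set"
    and u u_x u_y u_xx u_xy u_yx u_yy :: "real \<Rightarrow> real \<Rightarrow> real"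
    and F :: "real \<Rightarrow> real"
    and d \<omega> :: real
    and W :: "real ^ 'n \<Rightarrow> real"
  assumes "population cls"
    and "earning_potential y"
    and "consumption_utility Y u u_x u_y u_xx u_xy u_yx u_yy"
    and "\<And>a b s. s \<in> {0..1} \<Longrightarrow> y a b s \<in> Y"
    and "comparison_cost F"
    and "0 < d" and "\<omega> \<in> {0<..<1}"
    and "C1_bounded_partials W"
    and "strictly_increasing_in_each W"
    and "pigou_dalton W"
  shows "\<exists>s_lo s_hi. s_lo < s_y y \<and> s_y y < s_hi \<and>
    (\<forall>s\<in>{0<..<1}. s < s_hi \<longrightarrow>
      (\<forall>\<^sub>F \<rho> in at_left 1. \<forall>G. network cls d \<omega> \<rho> G \<longrightarrow>
        (\<exists>D>0. (equilibrium_welfare cls y u F W G has_real_derivative D) (at s)))) \<and>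
    (\<forall>s\<in>{0<..<1}. s > s_lo \<longrightarrow>
      (\<forall>\<^sub>F \<rho> in at_right 0. \<forall>G. network cls d \<omega> \<rho> G \<longrightarrow>
        (\<exists>D<0. (equilibrium_welfare cls y u F W G has_real_derivative D) (at s))))"
proof -
  obtain f f' where game: "status_game Y u u_x u_y u_xx u_xy u_yx u_yy F f f'"
    using status_game_if_comparison_cost assms by blast
  obtain DW m M where DW: "\<And>U. (W has_derivative (\<lambda>h. DW U \<bullet> h)) (at U)"
    "0 < m" "\<And>U i. m \<le> DW U $ i" "\<And>U i. DW U $ i \<le> M"
    using \<open>C1_bounded_partials W\<close> unfolding C1_bounded_partials_def by blast
  interpret society Y u u_x u_y u_xx u_xy u_yx u_yy F f f' y d \<omega> cls W DW m M
    using game assms DW by (simp add: society_def society_axioms_def)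
  let ?HP = "(High, Poor) :: agent_class" and ?LR = "(Low, Rich) :: agent_class"
  \<comment> \<open>The limit of the surviving intensity: of the ability links as \<rho> tends to 1
    and of the background links as \<rho> tends to 0.\<close>
  let ?c = "d * (1 - \<omega>)"
  have c: "0 < ?c" using d_pos \<omega> by simp
  obtain \<epsilon> where \<epsilon>: "0 < \<epsilon>"
    "\<And>s. s \<in> {0<..<1} \<Longrightarrow> dist s (s_y y) < \<epsilon> \<Longrightarrow> favours t_top ?c 0 (earn ?HP s) (earn ?LR s)"
    using favours_near_crossing[OF c, of ?HP ?LR] s_y_crossing(2) by auto
  obtain \<delta> where \<delta>: "0 < \<delta>"
    "\<And>s. s \<in> {0<..<1} \<Longrightarrow> dist s (s_y y) < \<delta> \<Longrightarrow> favours t_top ?c 0 (earn ?LR s) (earn ?HP s)"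
    using favours_near_crossing[OF c, of ?LR ?HP] s_y_crossing(2) by auto
  show ?thesis
  \<comment> \<open>The thresholds lie beyond the crossing by the radii found above; they may fall
    outside the unit interval.\<close>
  proof (rule exI[of _ "s_y y - \<delta>"], rule exI[of _ "s_y y + \<epsilon>"], intro conjI ballI impI)
    fix s :: real assume s: "s \<in> {0<..<1}" and less: "s < s_y y + \<epsilon>"
    obtain v where v: "0 < v" "(y High Poor has_real_derivative v) (at s)"
      "(y Low Rich has_real_derivative - v) (at s)"
      using y_deriv_HP_LR[OF s] by blast
    have fav: "favours t_top ?c 0 (earn ?HP s) (earn ?LR s)"
    \<comment> \<open>Up to the crossing the income order suffices; past it, \<open>s\<close> is
      within the radius of \<open>s_y\<close>.\<close>
    proof (cases "s \<le> s_y y")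
      case True
      then show ?thesis
        using c s t_top_pos lagging[OF s, of ?HP] y_gap_sign(1)[OF s]
        by (intro favours_poorer) (auto simp: y_in_Y)
    next
      case False
      then show ?thesis using less by (intro \<epsilon>(2) s) (simp add: dist_real_def)
    qed
    have "\<forall>\<^sub>F \<rho> in at_left 1. \<forall>G. network cls d \<omega> \<rho> G \<longrightarrow>
        (\<exists>E>0. (equilibrium_welfare cls y u F W G has_real_derivative v * E) (at s))"
    proof (rule welfare_deriv_eventually[OF s _ _ _ _ _ fav,
        where p = "\<lambda>\<rho>. d * (\<rho> * (1 - \<omega>))" and q = "\<lambda>\<rho>. d * ((1 - \<rho>) * (1 - \<omega>))"])
      show "middle_classes d \<omega> \<rho> ?HP ?LR (d * (\<rho> * (1 - \<omega>))) (d * ((1 - \<rho>) * (1 - \<omega>)))" for \<rho>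
        by (simp add: middle_classes_def)
      show "((\<lambda>\<rho>. d * (\<rho> * (1 - \<omega>))) \<longlongrightarrow> ?c) (at_left 1)"
        "((\<lambda>\<rho>. d * ((1 - \<rho>) * (1 - \<omega>))) \<longlongrightarrow> 0) (at_left 1)"
        by (auto intro!: tendsto_eq_intros)
    qed (use v c eventually_at_left_real[of 0 "1::real"] in auto)
    then show "\<forall>\<^sub>F \<rho> in at_left 1. \<forall>G. network cls d \<omega> \<rho> G \<longrightarrow>
        (\<exists>D>0. (equilibrium_welfare cls y u F W G has_real_derivative D) (at s))"
      by eventually_elim (use v(1) mult_pos_pos in blast)
  next
    fix s :: real assume s: "s \<in> {0<..<1}" and less: "s_y y - \<delta> < s"
    obtain v where v: "0 < v" "(y High Poor has_real_derivative v) (at s)"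
      "(y Low Rich has_real_derivative - v) (at s)"
      using y_deriv_HP_LR[OF s] by blast
    have fav: "favours t_top ?c 0 (earn ?LR s) (earn ?HP s)"
    proof (cases "s_y y \<le> s")
      case True
      then show ?thesis
        using c s t_top_pos lagging[OF s, of ?LR] y_gap_sign(2)[OF s]
        by (intro favours_poorer) (auto simp: y_in_Y)
    next
      case False
      then show ?thesis using less by (intro \<delta>(2) s) (simp add: dist_real_def)
    qed
    have "\<forall>\<^sub>F \<rho> in at_right 0. \<forall>G. network cls d \<omega> \<rho> G \<longrightarrow>
        (\<exists>E>0. (equilibrium_welfare cls y u F W G has_real_derivative - v * E) (at s))"
    \<comment> \<open>Now LR takes the place of A; its income falls at rate \<open>v\<close>, so
      \<alpha> is \<open>- v\<close> and the sign of the derivative flips.\<close>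
    proof (rule welfare_deriv_eventually[OF s _ _ _ _ _ fav,
        where q = "\<lambda>\<rho>. d * (\<rho> * (1 - \<omega>))" and p = "\<lambda>\<rho>. d * ((1 - \<rho>) * (1 - \<omega>))"])
      show "middle_classes d \<omega> \<rho> ?LR ?HP (d * ((1 - \<rho>) * (1 - \<omega>))) (d * (\<rho> * (1 - \<omega>)))" for \<rho>
        by (simp add: middle_classes_def)
      show "((\<lambda>\<rho>. d * ((1 - \<rho>) * (1 - \<omega>))) \<longlongrightarrow> ?c) (at_right 0)"
        "((\<lambda>\<rho>. d * (\<rho> * (1 - \<omega>))) \<longlongrightarrow> 0) (at_right 0)"
        by (auto intro!: tendsto_eq_intros)
    qed (use v c eventually_at_right_real[of 0 "1::real"] in auto)
    then show "\<forall>\<^sub>F \<rho> in at_right 0. \<forall>G. network cls d \<omega> \<rho> G \<longrightarrow>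
        (\<exists>D<0. (equilibrium_welfare cls y u F W G has_real_derivative D) (at s))"
      by eventually_elim (use v(1) in \<open>metis mult_neg_pos neg_less_0_iff_less\<close>)
  qed (use \<epsilon>(1) \<delta>(1) in simp_all)
qed

end
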